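(* Let $A$ and $B$ be groups, let $H \leqslant A$ and $K \leqslant B$ be subgroups, let $\varphi\colon H \to K$ be an isomorphism, and let $$G=\langle A * B;\ H = K,\ \varphi \rangle$$ be the free product of $A$ and $B$ with subgroups $H$ and $K$ amalgamated according to $\varphi$. Suppose that $H$ is a retract of $A$ and $K$ is a retract of $B$. Let $p$ be a prime number. I. If $A$ and $B$ are residually finite, then a cyclic subgroup of $G$ is finitely separable in $G$ if, and only if, it is not conjugate (in $G$) to any subgroup of the family $\Delta(A) \cup \Delta(B)$. II. If $A$ and $B$ are residually $p$-finite, then a $p'$-isolated cyclic subgroup of $G$ is $p$-separable in $G$ if, and only if, it is not conjugate (in $G$) to any subgroup of the family $\Delta_{p}(A) \cup \Delta_{p}(B)$.
   Context: The free product with amalgamation $\langle A * B;\ H=K,\ \varphi\rangle$ is the quotient of the free product $A * B$ by the normal closure of the elements $h^{-1}(h\varphi)$, $h \in H$; $A$ and $B$ are identified with their canonical images in it. A subgroup $Y$ of a group $X$ is a retract of $X$ if there exists a normal subgroup $F$ of $X$ such that $X = YF$ and $Y \cap F = 1$. A subgroup $Y$ of a group $X$ is finitely separable in $X$ if for any element $g \in X \setminus Y$ there exists a homomorphism $\psi$ of $X$ onto a finite group such that $g\psi \notin Y\psi$. A group is residually finite if its trivial subgroup is finitely separable. For a fixed prime $p$, the notions of $p$-separable subgroup and residually $p$-finite group are defined in the same way, with homomorphisms onto finite $p$-groups in place of homomorphisms onto arbitrary finite groups. A subgroup $Y$ of a group $X$ is $p'$-isolated in $X$ if for each $g \in X$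 and each prime number $q \neq p$, $g^{q} \in Y$ implies $g \in Y$. For a group $X$, $\Delta(X)$ denotes the family of all cyclic subgroups of $X$ which are not finitely separable in $X$, and $\Delta_p(X)$ denotes the family of all cyclic subgroups of $X$ which are $p'$-isolated in $X$ and are not $p$-separable in $X$. *)

theory Defs
  imports
    "HOL-Computational_Algebra.Primes"
    "HOL-Algebra.Generated_Groups"
begin

section \<open>Free products of two groups\<close>

abbreviation fp_words ::
  "('a, 'm) monoid_scheme \<Rightarrow> ('b, 'n) monoid_scheme \<Rightarrow> ('a + 'b) list set" where
  "fp_words A B \<equiv> lists (carrier A <+> carrier B)"

text \<open>The congruence on words that identifies the letters \<open>1\<^sub>A\<close> and \<open>1\<^sub>B\<close> with the empty word
  and multiplies adjacent letters from the same factor.\<close>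

inductive fp_eq ::
  "('a, 'm) monoid_scheme \<Rightarrow> ('b, 'n) monoid_scheme \<Rightarrow> ('a + 'b) list \<Rightarrow> ('a + 'b) list \<Rightarrow> bool"
  for A B where
  refl: "w \<in> fp_words A B \<Longrightarrow> fp_eq A B w w"
| sym: "fp_eq A B v w \<Longrightarrow> fp_eq A B w v"
| trans: "fp_eq A B u v \<Longrightarrow> fp_eq A B v w \<Longrightarrow> fp_eq A B u w"
| one_left: "u \<in> fp_words A B \<Longrightarrow> v \<in> fp_words A B \<Longrightarrow> fp_eq A B (u @ Inl \<one>\<^bsub>A\<^esub> # v) (u @ v)"
| one_right: "u \<in> fp_words A B \<Longrightarrow> v \<in> fp_words A B \<Longrightarrow> fp_eq A B (u @ Inr \<one>\<^bsub>B\<^esub> # v) (u @ v)"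
| mult_left: "u \<in> fp_words A B \<Longrightarrow> v \<in> fp_words A B \<Longrightarrow> a \<in> carrier A \<Longrightarrow> a' \<in> carrier A \<Longrightarrow>
    fp_eq A B (u @ Inl a # Inl a' # v) (u @ Inl (a \<otimes>\<^bsub>A\<^esub> a') # v)"
| mult_right: "u \<in> fp_words A B \<Longrightarrow> v \<in> fp_words A B \<Longrightarrow> b \<in> carrier B \<Longrightarrow> b' \<in> carrier B \<Longrightarrow>
    fp_eq A B (u @ Inr b # Inr b' # v) (u @ Inr (b \<otimes>\<^bsub>B\<^esub> b') # v)"

definition fp_class ::
  "('a, 'm) monoid_scheme \<Rightarrow> ('b, 'n) monoid_scheme \<Rightarrow> ('a + 'b) list \<Rightarrow> ('a + 'b) list set" where
  "fp_class A B w = {v. fp_eq A B w v}"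

definition free_product ::
  "('a, 'm) monoid_scheme \<Rightarrow> ('b, 'n) monoid_scheme \<Rightarrow> ('a + 'b) list set monoid" where
  "free_product A B =
    \<lparr>carrier = fp_class A B ` fp_words A B,
     mult = (\<lambda>X Y. \<Union>x\<in>X. \<Union>y\<in>Y. fp_class A B (x @ y)),
     one = fp_class A B []\<rparr>"

definition fp_inl ::
  "('a, 'm) monoid_scheme \<Rightarrow> ('b, 'n) monoid_scheme \<Rightarrow> 'a \<Rightarrow> ('a + 'b) list set" where
  "fp_inl A B a = fp_class A B [Inl a]"

definition fp_inr ::
  "('a, 'm) monoid_scheme \<Rightarrow> ('b, 'n) monoid_scheme \<Rightarrow> 'b \<Rightarrow> ('a + 'b) list set" where
  "fp_inr A B b = fp_class A B [Inr b]"


section \<open>Free products with amalgamation\<close>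

definition normal_closure :: "('a, 'm) monoid_scheme \<Rightarrow> 'a set \<Rightarrow> 'a set" where
  "normal_closure X S = \<Inter>{N. N \<lhd> X \<and> S \<subseteq> N}"

definition amalg_kernel ::
  "('a, 'm) monoid_scheme \<Rightarrow> ('b, 'n) monoid_scheme \<Rightarrow> 'a set \<Rightarrow> ('a \<Rightarrow> 'b) \<Rightarrow> ('a + 'b) list set set" where
  "amalg_kernel A B H \<phi> = normal_closure (free_product A B)
    ((\<lambda>h. inv\<^bsub>free_product A B\<^esub> (fp_inl A B h) \<otimes>\<^bsub>free_product A B\<^esub> fp_inr A B (\<phi> h)) ` H)"

text \<open>The second amalgamated subgroup is not an argument: it is \<open>\<phi> ` H\<close>.\<close>

definition amalgam ::
  "('a, 'm) monoid_scheme \<Rightarrow> ('b, 'n) monoid_scheme \<Rightarrow> 'a set \<Rightarrow> ('a \<Rightarrow> 'b)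
    \<Rightarrow> ('a + 'b) list set set monoid" where
  "amalgam A B H \<phi> = free_product A B Mod amalg_kernel A B H \<phi>"

definition amalgam_inl ::
  "('a, 'm) monoid_scheme \<Rightarrow> ('b, 'n) monoid_scheme \<Rightarrow> 'a set \<Rightarrow> ('a \<Rightarrow> 'b)
    \<Rightarrow> 'a \<Rightarrow> ('a + 'b) list set set" where
  "amalgam_inl A B H \<phi> a = amalg_kernel A B H \<phi> #>\<^bsub>free_product A B\<^esub> fp_inl A B a"

definition amalgam_inr ::
  "('a, 'm) monoid_scheme \<Rightarrow> ('b, 'n) monoid_scheme \<Rightarrow> 'a set \<Rightarrow> ('a \<Rightarrow> 'b)
    \<Rightarrow> 'b \<Rightarrow> ('a + 'b) list set set" where
  "amalgam_inr A B H \<phi> b = amalg_kernel A B H \<phi> #>\<^bsub>free_product A B\<^esub> fp_inr A B b"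


section \<open>Retracts, separability, isolated subgroups\<close>

definition retract_of_group :: "'a set \<Rightarrow> ('a, 'm) monoid_scheme \<Rightarrow> bool" where
  "retract_of_group Y X \<longleftrightarrow> subgroup Y X \<and>
    (\<exists>F. F \<lhd> X \<and> carrier X = Y <#>\<^bsub>X\<^esub> F \<and> Y \<inter> F = {\<one>\<^bsub>X\<^esub>})"

text \<open>HOL cannot quantify over the type of the finite target group inside a formula. Targets with
  elements in \<open>nat\<close> suffice, since every finite group is isomorphic to such a group; see
  \<open>finitely_separableI\<close> and \<open>p_separableI\<close> below.\<close>

definition finitely_separable :: "'a set \<Rightarrow> ('a, 'm) monoid_scheme \<Rightarrow> bool" where
  "finitely_separable Y X \<longleftrightarrow> subgroup Y X \<and>
    (\<forall>g \<in> carrier X - Y. \<exists>(Q :: nat monoid) \<psi>.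
      group Q \<and> finite (carrier Q) \<and> \<psi> \<in> epi X Q \<and> \<psi> g \<notin> \<psi> ` Y)"

definition finite_p_group :: "nat \<Rightarrow> ('a, 'm) monoid_scheme \<Rightarrow> bool" where
  "finite_p_group p Q \<longleftrightarrow> group Q \<and> finite (carrier Q) \<and> (\<exists>n. order Q = p ^ n)"

definition p_separable :: "nat \<Rightarrow> 'a set \<Rightarrow> ('a, 'm) monoid_scheme \<Rightarrow> bool" where
  "p_separable p Y X \<longleftrightarrow> subgroup Y X \<and>
    (\<forall>g \<in> carrier X - Y. \<exists>(Q :: nat monoid) \<psi>.
      finite_p_group p Q \<and> \<psi> \<in> epi X Q \<and> \<psi> g \<notin> \<psi> ` Y)"

definition residually_finite :: "('a, 'm) monoid_scheme \<Rightarrow> bool" where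
  "residually_finite X \<longleftrightarrow> finitely_separable {\<one>\<^bsub>X\<^esub>} X"

definition residually_p_finite :: "nat \<Rightarrow> ('a, 'm) monoid_scheme \<Rightarrow> bool" where
  "residually_p_finite p X \<longleftrightarrow> p_separable p {\<one>\<^bsub>X\<^esub>} X"

definition p'_isolated :: "nat \<Rightarrow> 'a set \<Rightarrow> ('a, 'm) monoid_scheme \<Rightarrow> bool" where
  "p'_isolated p Y X \<longleftrightarrow> subgroup Y X \<and>
    (\<forall>g \<in> carrier X. \<forall>q::nat. prime q \<and> q \<noteq> p \<longrightarrow> g [^]\<^bsub>X\<^esub> q \<in> Y \<longrightarrow> g \<in> Y)"

definition cyclic_subgroup :: "'a set \<Rightarrow> ('a, 'm) monoid_scheme \<Rightarrow> bool" where
  "cyclic_subgroup Y X \<longleftrightarrow> (\<exists>g \<in> carrier X. Y = generate X {g})"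

definition conjugate_in :: "('a, 'm) monoid_scheme \<Rightarrow> 'a set \<Rightarrow> 'a set \<Rightarrow> bool" where
  "conjugate_in X Y Z \<longleftrightarrow> (\<exists>g \<in> carrier X. Z = (\<lambda>y. inv\<^bsub>X\<^esub> g \<otimes>\<^bsub>X\<^esub> y \<otimes>\<^bsub>X\<^esub> g) ` Y)"

definition Delta :: "('a, 'm) monoid_scheme \<Rightarrow> 'a set set" where
  "Delta X = {Y. cyclic_subgroup Y X \<and> \<not> finitely_separable Y X}"

definition Delta_p :: "nat \<Rightarrow> ('a, 'm) monoid_scheme \<Rightarrow> 'a set set" where
  "Delta_p p X = {Y. cyclic_subgroup Y X \<and> p'_isolated p Y X \<and> \<not> p_separable p Y X}"


section \<open>Well-definedness\<close>

lemma fp_eq_words: "fp_eq A B v w \<Longrightarrow> group A \<Longrightarrow> group B \<Longrightarrow> v \<in> fp_words A B \<and> w \<in> fp_words A B"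
  by (induction rule: fp_eq.induct)
    (auto simp: group.is_monoid monoid.m_closed group.subgroup_self monoid.one_closed)

lemma fp_eq_append1:
  assumes "fp_eq A B v w" "t \<in> fp_words A B"
  shows "fp_eq A B (t @ v) (t @ w)"
  using assms
proof (induction rule: fp_eq.induct)
  case (one_left u v)
  then show ?case using fp_eq.one_left[of "t @ u" A B v] by simp
next
  case (one_right u v)
  then show ?case using fp_eq.one_right[of "t @ u" A B v] by simp
next
  case (mult_left u v a a')
  then show ?case using fp_eq.mult_left[of "t @ u" A B v a a'] by simp
next
  case (mult_right u v b b')
  then show ?case using fp_eq.mult_right[of "t @ u" A B v b b'] by simp
next
  case (refl w)
  then show ?case using fp_eq.refl[of "t @ w" A B] by simp
qed (auto intro: fp_eq.sym fp_eq.trans)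

lemma fp_eq_append2:
  assumes "fp_eq A B v w" "t \<in> fp_words A B"
  shows "fp_eq A B (v @ t) (w @ t)"
  using assms
proof (induction rule: fp_eq.induct)
  case (one_left u v)
  then show ?case using fp_eq.one_left[of u A B "v @ t"] by simp
next
  case (one_right u v)
  then show ?case using fp_eq.one_right[of u A B "v @ t"] by simp
next
  case (mult_left u v a a')
  then show ?case using fp_eq.mult_left[of u A B "v @ t" a a'] by simp
next
  case (mult_right u v b b')
  then show ?case using fp_eq.mult_right[of u A B "v @ t" b b'] by simp
next
  case (refl w)
  then show ?case using fp_eq.refl[of "w @ t" A B] by simp
qed (auto intro: fp_eq.sym fp_eq.trans)

lemma fp_class_eqI: "fp_eq A B v w \<Longrightarrow> fp_class A B v = fp_class A B w"
  unfolding fp_class_def by (blast intro: fp_eq.sym fp_eq.trans)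

lemma fp_class_eqD: "fp_class A B v = fp_class A B w \<Longrightarrow> w \<in> fp_words A B \<Longrightarrow> fp_eq A B v w"
  unfolding fp_class_def by (blast intro: fp_eq.refl)

lemma fp_mult:
  assumes "group A" "group B" "v \<in> fp_words A B" "w \<in> fp_words A B"
  shows "fp_class A B v \<otimes>\<^bsub>free_product A B\<^esub> fp_class A B w = fp_class A B (v @ w)"
proof -
  have *: "fp_class A B (x @ y) = fp_class A B (v @ w)" if "fp_eq A B v x" "fp_eq A B w y" for x y
  proof -
    have "fp_eq A B (x @ y) (x @ w)"
      using that fp_eq_append1 fp_eq_words assms fp_eq.sym by metis
    moreover have "fp_eq A B (x @ w) (v @ w)"
      using that fp_eq_append2 assms fp_eq.sym by metis
    ultimately show ?thesis by (metis fp_class_eqI)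
  qed
  have vw: "v \<in> fp_class A B v" "w \<in> fp_class A B w"
    unfolding fp_class_def using assms by (auto intro: fp_eq.refl)
  have eq: "fp_class A B (x @ y) = fp_class A B (v @ w)"
    if "x \<in> fp_class A B v" "y \<in> fp_class A B w" for x y
    using * that unfolding fp_class_def by blast
  have "(\<Union>y\<in>fp_class A B w. fp_class A B (x @ y)) = fp_class A B (v @ w)"
    if "x \<in> fp_class A B v" for x
    by (intro UN_constant_eq[OF vw(2)] ballI eq[OF that])
  then have "(\<Union>x\<in>fp_class A B v. \<Union>y\<in>fp_class A B w. fp_class A B (x @ y)) = fp_class A B (v @ w)"
    by (intro UN_constant_eq[OF vw(1)] ballI)
  then show ?thesis
    by (simp add: free_product_def)
qed

lemma fp_left_inverse:
  assumes "group A" "group B" "w \<in> fp_words A B"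
  shows "\<exists>v \<in> fp_words A B. fp_eq A B (v @ w) []"
  using assms(3)
proof (induction w)
  case Nil
  then show ?case by (auto intro: fp_eq.refl)
next
  case (Cons x w)
  then obtain v where v: "v \<in> fp_words A B" "fp_eq A B (v @ w) []" by auto
  have w: "w \<in> fp_words A B" using Cons by auto
  interpret A: group A by fact
  interpret B: group B by fact
  obtain y where y: "[y] \<in> fp_words A B" "fp_eq A B (v @ y # x # w) (v @ w)"
  proof (cases x)
    case (Inl a)
    then have a: "a \<in> carrier A" using Cons by auto
    show ?thesis
    proof (rule that[of "Inl (inv\<^bsub>A\<^esub> a)"])
      show "fp_eq A B (v @ Inl (inv\<^bsub>A\<^esub> a) # x # w) (v @ w)"
        using fp_eq.mult_left[OF v(1) w, of "inv\<^bsub>A\<^esub> a" a] fp_eq.one_left[OF v(1) w] a Inl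
        by (auto intro: fp_eq.trans)
    qed (use a in auto)
  next
    case (Inr b)
    then have b: "b \<in> carrier B" using Cons by auto
    show ?thesis
    proof (rule that[of "Inr (inv\<^bsub>B\<^esub> b)"])
      show "fp_eq A B (v @ Inr (inv\<^bsub>B\<^esub> b) # x # w) (v @ w)"
        using fp_eq.mult_right[OF v(1) w, of "inv\<^bsub>B\<^esub> b" b] fp_eq.one_right[OF v(1) w] b Inr
        by (auto intro: fp_eq.trans)
    qed (use b in auto)
  qed
  have "fp_eq A B ((v @ [y]) @ x # w) []" using y v by (auto intro: fp_eq.trans)
  moreover have "v @ [y] \<in> fp_words A B" using v y by auto
  ultimately show ?case by blast
qed

lemma group_free_product:
  assumes "group A" "group B"
  shows "group (free_product A B)"
proof (rule groupI)
  fix x y assume "x \<in> carrier (free_product A B)" "y \<in> carrier (free_product A B)"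
  then obtain v w where "v \<in> fp_words A B" "w \<in> fp_words A B"
    "x = fp_class A B v" "y = fp_class A B w"
    unfolding free_product_def by auto
  moreover have "v @ w \<in> fp_words A B" using calculation by simp
  ultimately show "x \<otimes>\<^bsub>free_product A B\<^esub> y \<in> carrier (free_product A B)"
    by (simp add: fp_mult[OF assms]) (simp add: free_product_def)
next
  show "\<one>\<^bsub>free_product A B\<^esub> \<in> carrier (free_product A B)" by (auto simp: free_product_def)
next
  fix x y z assume "x \<in> carrier (free_product A B)" "y \<in> carrier (free_product A B)"
    "z \<in> carrier (free_product A B)"
  then obtain u v w where "u \<in> fp_words A B" "v \<in> fp_words A B" "w \<in> fp_words A B"
    "x = fp_class A B u" "y = fp_class A B v" "z = fp_class A B w"
    unfolding free_product_def by auto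
  then show "x \<otimes>\<^bsub>free_product A B\<^esub> y \<otimes>\<^bsub>free_product A B\<^esub> z
      = x \<otimes>\<^bsub>free_product A B\<^esub> (y \<otimes>\<^bsub>free_product A B\<^esub> z)"
    by (simp add: fp_mult[OF assms])
next
  fix x assume "x \<in> carrier (free_product A B)"
  then obtain w where w: "w \<in> fp_words A B" "x = fp_class A B w"
    unfolding free_product_def by auto
  have one: "\<one>\<^bsub>free_product A B\<^esub> = fp_class A B []"
    by (simp add: free_product_def)
  show "\<one>\<^bsub>free_product A B\<^esub> \<otimes>\<^bsub>free_product A B\<^esub> x = x"
    using w by (simp add: one fp_mult[OF assms])
  obtain v where v: "v \<in> fp_words A B" "fp_eq A B (v @ w) []"
    using fp_left_inverse[OF assms w(1)] by blast
  show "\<exists>y\<in>carrier (free_product A B). y \<otimes>\<^bsub>free_product A B\<^esub> x = \<one>\<^bsub>free_product A B\<^esub>"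
  proof
    show "fp_class A B v \<otimes>\<^bsub>free_product A B\<^esub> x = \<one>\<^bsub>free_product A B\<^esub>"
      using v w fp_class_eqI[OF v(2)] by (simp add: one fp_mult[OF assms])
    show "fp_class A B v \<in> carrier (free_product A B)"
      using v by (simp add: free_product_def)
  qed
qed

lemma fp_inl_hom:
  assumes "group A" "group B"
  shows "fp_inl A B \<in> hom A (free_product A B)"
proof (rule homI)
  show "fp_inl A B a \<in> carrier (free_product A B)" if "a \<in> carrier A" for a
    using that by (auto simp: fp_inl_def free_product_def)
  show "fp_inl A B (a \<otimes>\<^bsub>A\<^esub> a') = fp_inl A B a \<otimes>\<^bsub>free_product A B\<^esub> fp_inl A B a'"
    if "a \<in> carrier A" "a' \<in> carrier A" for a a'
    using that fp_eq.mult_left[of "[]" A B "[]" a a', THEN fp_class_eqI]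
    by (simp add: fp_inl_def fp_mult[OF assms] InlI)
qed

lemma fp_inr_hom:
  assumes "group A" "group B"
  shows "fp_inr A B \<in> hom B (free_product A B)"
proof (rule homI)
  show "fp_inr A B b \<in> carrier (free_product A B)" if "b \<in> carrier B" for b
    using that by (auto simp: fp_inr_def free_product_def)
  show "fp_inr A B (b \<otimes>\<^bsub>B\<^esub> b') = fp_inr A B b \<otimes>\<^bsub>free_product A B\<^esub> fp_inr A B b'"
    if "b \<in> carrier B" "b' \<in> carrier B" for b b'
    using that fp_eq.mult_right[of "[]" A B "[]" b b', THEN fp_class_eqI]
    by (simp add: fp_inr_def fp_mult[OF assms] InrI)
qed

text \<open>Existence part of the universal property.\<close>

lemma free_product_lift:
  assumes "group A" "group B" "group X" "f \<in> hom A X" "g \<in> hom B X"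
  shows "\<exists>h \<in> hom (free_product A B) X.
    (\<forall>a \<in> carrier A. h (fp_inl A B a) = f a) \<and> (\<forall>b \<in> carrier B. h (fp_inr A B b) = g b)"
proof -
  interpret A: group A by fact
  interpret B: group B by fact
  interpret X: group X by fact
  interpret f: group_hom A X f by unfold_locales fact
  interpret g: group_hom B X g by unfold_locales fact
  define e where "e w = foldr (\<lambda>l x. case_sum f g l \<otimes>\<^bsub>X\<^esub> x) w \<one>\<^bsub>X\<^esub>" for w
  have e_simps [simp]: "e [] = \<one>\<^bsub>X\<^esub>" "e (l # w) = case_sum f g l \<otimes>\<^bsub>X\<^esub> e w" for l w
    by (simp_all add: e_def)
  have e_closed [simp]: "e w \<in> carrier X" if "w \<in> fp_words A B" for w
    using that by (induction w) auto
  have e_append [simp]: "e (v @ w) = e v \<otimes>\<^bsub>X\<^esub> e w"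
    if "v \<in> fp_words A B" "w \<in> fp_words A B" for v w
    using that(1)
  proof (induction v)
    case (Cons l v)
    then have "case_sum f g l \<in> carrier X" "e v \<in> carrier X" "e w \<in> carrier X"
      using that(2) by auto
    with Cons show ?case by (simp add: X.m_assoc)
  qed (use that in simp)
  have e_eq: "e v = e w" if "fp_eq A B v w" for v w
    using that by (induction rule: fp_eq.induct) (simp_all add: InlI InrI X.m_assoc)
  define h where "h Y = e (SOME w. w \<in> Y)" for Y
  have h_class: "h (fp_class A B w) = e w" if "w \<in> fp_words A B" for w
  proof -
    have "fp_eq A B w (SOME v. v \<in> fp_class A B w)"
      using someI[of "\<lambda>v. v \<in> fp_class A B w" w] fp_eq.refl[OF that] by (simp add: fp_class_def)
    then show ?thesis unfolding h_def using e_eq by simp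
  qed
  have "h \<in> hom (free_product A B) X"
  proof (rule homI)
    fix x assume "x \<in> carrier (free_product A B)"
    then obtain w where "w \<in> fp_words A B" "x = fp_class A B w"
      by (auto simp: free_product_def)
    then show "h x \<in> carrier X" by (simp only: h_class e_closed)
  next
    fix x y assume "x \<in> carrier (free_product A B)" "y \<in> carrier (free_product A B)"
    then obtain v w where "v \<in> fp_words A B" "w \<in> fp_words A B"
      "x = fp_class A B v" "y = fp_class A B w"
      by (auto simp: free_product_def)
    then show "h (x \<otimes>\<^bsub>free_product A B\<^esub> y) = h x \<otimes>\<^bsub>X\<^esub> h y"
      by (simp add: fp_mult[OF assms(1,2)] h_class)
  qed
  moreover have "\<forall>a \<in> carrier A. h (fp_inl A B a) = f a"
    by (simp add: fp_inl_def h_class InlI)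
  moreover have "\<forall>b \<in> carrier B. h (fp_inr A B b) = g b"
    by (simp add: fp_inr_def h_class InrI)
  ultimately show ?thesis by blast
qed

lemma normal_closure_normal:
  assumes "group X" "S \<subseteq> carrier X"
  shows "normal_closure X S \<lhd> X"
proof -
  interpret group X by fact
  have car: "carrier X \<in> {N. N \<lhd> X \<and> S \<subseteq> N}"
    using assms(2) by (auto simp: normal_inv_iff subgroup_self)
  have "subgroup (\<Inter>{N. N \<lhd> X \<and> S \<subseteq> N}) X"
    by (rule subgroups_Inter) (use car in \<open>auto simp: normal_imp_subgroup\<close>)
  then show ?thesis
    unfolding normal_closure_def normal_inv_iff by (auto simp: normal_inv_iff)
qed

lemma normal_closure_superset: "S \<subseteq> normal_closure X S"
  unfolding normal_closure_def by blast

lemma amalg_kernel_normal: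
  assumes "group A" "group B" "H \<subseteq> carrier A" "\<phi> ` H \<subseteq> carrier B"
  shows "amalg_kernel A B H \<phi> \<lhd> free_product A B"
proof -
  interpret P: group "free_product A B" using assms by (intro group_free_product)
  show ?thesis
    unfolding amalg_kernel_def
    using fp_inl_hom[OF assms(1,2)] fp_inr_hom[OF assms(1,2)] assms(3,4)
    by (intro normal_closure_normal P.group_axioms) (auto simp: hom_def Pi_iff image_subset_iff subset_iff)
qed

lemma group_amalgam:
  assumes "group A" "group B" "H \<subseteq> carrier A" "\<phi> ` H \<subseteq> carrier B"
  shows "group (amalgam A B H \<phi>)"
  unfolding amalgam_def by (rule normal.factorgroup_is_group[OF amalg_kernel_normal[OF assms]])

lemma amalgam_inl_hom:
  assumes "group A" "group B" "H \<subseteq> carrier A" "\<phi> ` H \<subseteq> carrier B"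
  shows "amalgam_inl A B H \<phi> \<in> hom A (amalgam A B H \<phi>)"
  using hom_compose[OF fp_inl_hom[OF assms(1,2)] normal.r_coset_hom_Mod[OF amalg_kernel_normal[OF assms]]]
  by (simp add: amalgam_inl_def[abs_def] amalgam_def comp_def)

lemma amalgam_inr_hom:
  assumes "group A" "group B" "H \<subseteq> carrier A" "\<phi> ` H \<subseteq> carrier B"
  shows "amalgam_inr A B H \<phi> \<in> hom B (amalgam A B H \<phi>)"
  using hom_compose[OF fp_inr_hom[OF assms(1,2)] normal.r_coset_hom_Mod[OF amalg_kernel_normal[OF assms]]]
  by (simp add: amalgam_inr_def[abs_def] amalgam_def comp_def)

lemma amalgam_inl_eq_inr:
  assumes "group A" "group B" "H \<subseteq> carrier A" "\<phi> ` H \<subseteq> carrier B" "h \<in> H"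
  shows "amalgam_inl A B H \<phi> h = amalgam_inr A B H \<phi> (\<phi> h)"
proof -
  interpret P: group "free_product A B" using assms by (intro group_free_product)
  interpret N: normal "amalg_kernel A B H \<phi>" "free_product A B"
    by (rule amalg_kernel_normal[OF assms(1-4)])
  let ?x = "fp_inl A B h" and ?y = "fp_inr A B (\<phi> h)"
  have x: "?x \<in> carrier (free_product A B)" and y: "?y \<in> carrier (free_product A B)"
    using fp_inl_hom[OF assms(1,2)] fp_inr_hom[OF assms(1,2)] assms(3-5)
    by (auto simp: hom_def Pi_iff)
  have "inv\<^bsub>free_product A B\<^esub> ?x \<otimes>\<^bsub>free_product A B\<^esub> ?y \<in> amalg_kernel A B H \<phi>"
    unfolding amalg_kernel_def by (rule subsetD[OF normal_closure_superset]) (use assms(5) in blast)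
  then have "?x \<otimes>\<^bsub>free_product A B\<^esub> (inv\<^bsub>free_product A B\<^esub> ?x \<otimes>\<^bsub>free_product A B\<^esub> ?y)
      \<in> ?x <#\<^bsub>free_product A B\<^esub> amalg_kernel A B H \<phi>"
    unfolding l_coset_def by blast
  then have "?y \<in> amalg_kernel A B H \<phi> #>\<^bsub>free_product A B\<^esub> ?x"
    using x y N.coset_eq by (simp flip: P.m_assoc)
  then show ?thesis
    unfolding amalgam_inl_def amalgam_inr_def
    by (intro P.repr_independence x N.subgroup_axioms)
qed

lemma finite_group_nat_copy:
  assumes "group Q" "finite (carrier Q)"
  shows "\<exists>(R :: nat monoid) f. group R \<and> f \<in> iso Q R"
proof -
  obtain f :: "'a \<Rightarrow> nat" where f: "inj_on f (carrier Q)"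
    using finite_imp_inj_to_nat_seg[OF assms(2)] by blast
  define i where "i = inv_into (carrier Q) f"
  define R where "R = \<lparr>carrier = f ` carrier Q, mult = (\<lambda>x y. f (i x \<otimes>\<^bsub>Q\<^esub> i y)), one = f \<one>\<^bsub>Q\<^esub>\<rparr>"
  have iso: "f \<in> iso Q R"
    using f assms(1) by (auto simp: iso_def hom_def R_def i_def bij_betw_def)
  then have "group (R\<lparr>one := f \<one>\<^bsub>Q\<^esub>\<rparr>)"
    using group.iso_imp_img_group[OF assms(1)] by blast
  then have "group R" by (simp add: R_def)
  with iso show ?thesis by blast
qed

lemma nat_target:
  fixes Q :: "('q, 'n) monoid_scheme"
  assumes "group Q" "finite (carrier Q)" "\<psi> \<in> epi X Q" "g \<in> carrier X" "Y \<subseteq> carrier X" "\<psi> g \<notin> \<psi> ` Y"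
  shows "\<exists>(R :: nat monoid) \<chi>. group R \<and> finite (carrier R) \<and> order R = order Q \<and>
    \<chi> \<in> epi X R \<and> \<chi> g \<notin> \<chi> ` Y"
proof -
  obtain R :: "nat monoid" and f where R: "group R" "f \<in> iso Q R"
    using finite_group_nat_copy[OF assms(1,2)] by blast
  have bij: "bij_betw f (carrier Q) (carrier R)" using R(2) by (simp add: iso_def)
  have img: "\<psi> ` carrier X \<subseteq> carrier Q" using assms(3) by (simp add: epi_def)
  have "f (\<psi> g) \<notin> f ` \<psi> ` Y"
    using inj_on_image_mem_iff[OF bij_betw_imp_inj_on[OF bij], of "\<psi> g" "\<psi> ` Y"] img assms(4-6) by blast
  moreover have "f \<circ> \<psi> \<in> epi X R"
    by (rule epi_compose[OF assms(3)]) (use R(2) in \<open>simp add: iso_iff_mon_epi\<close>)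
  moreover have "order R = order Q" "finite (carrier R)"
    using bij assms(2) by (auto simp: order_def bij_betw_same_card bij_betw_finite)
  ultimately show ?thesis using R(1) by (metis comp_apply image_comp)
qed

lemma finitely_separableI:
  fixes X :: "('a, 'm) monoid_scheme"
  assumes "subgroup Y X"
    and "\<And>g. g \<in> carrier X - Y \<Longrightarrow> \<exists>(Q :: ('q, 'n) monoid_scheme) \<psi>.
      group Q \<and> finite (carrier Q) \<and> \<psi> \<in> epi X Q \<and> \<psi> g \<notin> \<psi> ` Y"
  shows "finitely_separable Y X"
  unfolding finitely_separable_def
proof (intro conjI ballI)
  fix g assume g: "g \<in> carrier X - Y"
  from assms(2)[OF g] obtain Q :: "('q, 'n) monoid_scheme" and \<psi> where
    "group Q" "finite (carrier Q)" "\<psi> \<in> epi X Q" "\<psi> g \<notin> \<psi> ` Y" by blast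
  then show "\<exists>(Q :: nat monoid) \<psi>. group Q \<and> finite (carrier Q) \<and> \<psi> \<in> epi X Q \<and> \<psi> g \<notin> \<psi> ` Y"
    using nat_target[of Q \<psi> X g Y] g subgroup.subset[OF assms(1)] by blast
qed (fact assms(1))

lemma p_separableI:
  fixes X :: "('a, 'm) monoid_scheme"
  assumes "subgroup Y X"
    and "\<And>g. g \<in> carrier X - Y \<Longrightarrow> \<exists>(Q :: ('q, 'n) monoid_scheme) \<psi>.
      finite_p_group p Q \<and> \<psi> \<in> epi X Q \<and> \<psi> g \<notin> \<psi> ` Y"
  shows "p_separable p Y X"
  unfolding p_separable_def
proof (intro conjI ballI)
  fix g assume g: "g \<in> carrier X - Y"
  from assms(2)[OF g] obtain Q :: "('q, 'n) monoid_scheme" and \<psi> k where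
    "group Q" "finite (carrier Q)" "order Q = p ^ k" "\<psi> \<in> epi X Q" "\<psi> g \<notin> \<psi> ` Y"
    unfolding finite_p_group_def by blast
  then show "\<exists>(Q :: nat monoid) \<psi>. finite_p_group p Q \<and> \<psi> \<in> epi X Q \<and> \<psi> g \<notin> \<psi> ` Y"
    unfolding finite_p_group_def
    using nat_target[of Q \<psi> X g Y] g subgroup.subset[OF assms(1)] by fastforce
qed (fact assms(1))

end

theory Submission
  imports Defs "HOL-Algebra.Sylow" "HOL-Algebra.Multiplicative_Group"
begin

text \<open>
  Both parts are instances of one statement about a set \<open>\<P>\<close> of admissible exponents (all positive
  integers, or all powers of \<open>p\<close>): a finite group is admissible if its exponent lies in \<open>\<P>\<close>.

  The key is a family of representations of \<open>G\<close> on integer-valued functions on words over a finite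
  quotient \<open>P\<close> of \<open>G\<close>. The amalgamated subgroup acts by left multiplication on all letters. On words
  whose length has one parity, \<open>A\<close> acts on the tail through its retraction onto the amalgamated
  subgroup and on the head by itself, and also feeds the value at the tail into the value at the
  word; on words of the other parity it acts through the retraction, and \<open>B\<close> behaves the other way
  round. An alternating product of \<open>m\<close> elements then moves the basis vector of the empty word to a
  function with value \<open>\<plusminus>1\<close> at a word of length \<open>m\<close>. Reducing modulo \<open>N \<in> \<P>\<close> and truncating at a word
  length gives admissible finite quotients of \<open>G\<close>, so \<open>G\<close> is residually admissible, and cyclic
  subgroups inside a factor are then handled by the retraction of \<open>G\<close> onto that factor.

  If \<open>c\<close> is not conjugate into a factor, it is conjugate to a cyclically reduced word of even length,
  so a power \<open>c\<^sup>e\<close> acts unipotently and nontrivially. At the lowest word length where \<open>c\<^sup>e\<close> is visible,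
  its powers add up like integers, and congruences modulo \<open>N\<close> bound the \<open>j\<close> for which an
  element \<open>g\<close> can coincide with \<open>c\<^sup>j\<close> in the quotient.
\<close>

section \<open>Normal subgroups with finite quotients of restricted exponent\<close>

text \<open>The exponent of the quotient is restricted rather than its order, so admissibility is
  proved by exhibiting one exponent. For powers of a prime both restrictions describe the same
  finite groups.\<close>

definition open_normal :: "nat set \<Rightarrow> ('a, 'm) monoid_scheme \<Rightarrow> 'a set \<Rightarrow> bool" where
  "open_normal \<P> X U \<longleftrightarrow> U \<lhd> X \<and> finite (rcosets\<^bsub>X\<^esub> U) \<and>
    (\<exists>e \<in> \<P>. \<forall>x \<in> carrier X. x [^]\<^bsub>X\<^esub> e \<in> U)"

text \<open>The condition says that the coset of \<open>g\<close> is not the coset of any element of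
  \<open>Y\<close>, so \<open>U\<close> is the kernel of a homomorphism that separates
  \<open>g\<close> from \<open>Y\<close>.\<close>

definition separable :: "nat set \<Rightarrow> 'a set \<Rightarrow> ('a, 'm) monoid_scheme \<Rightarrow> bool" where
  "separable \<P> Y X \<longleftrightarrow> subgroup Y X \<and>
    (\<forall>g \<in> carrier X - Y. \<exists>U. open_normal \<P> X U \<and> (\<forall>y \<in> Y. g \<otimes>\<^bsub>X\<^esub> inv\<^bsub>X\<^esub> y \<notin> U))"

lemma (in group) rcos_eq_iff:
  assumes "subgroup U G" "x \<in> carrier G" "y \<in> carrier G"
  shows "U #> x = U #> y \<longleftrightarrow> x \<otimes> inv y \<in> U"
proof
  assume "U #> x = U #> y"
  then have "x \<in> U #> y" using rcos_self[OF assms(2,1)] by simp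
  then obtain u where "u \<in> U" "x = u \<otimes> y" unfolding r_coset_def by auto
  then show "x \<otimes> inv y \<in> U"
    using assms subgroup.mem_carrier[OF assms(1)] by (simp add: m_assoc)
next
  assume a: "x \<otimes> inv y \<in> U"
  have "x = (x \<otimes> inv y) \<otimes> y" using assms by (simp add: m_assoc)
  then have "x \<in> U #> y" using a unfolding r_coset_def by blast
  then show "U #> x = U #> y" using repr_independence[OF _ assms(3,1)] by simp
qed

text \<open>Elements with equal values of \<open>F\<close> lie in one coset, so a coset is recovered
  from the value at any of its elements and the finitely many values bound the index.\<close>

lemma (in group) finite_rcosetsI:
  assumes "subgroup U G" "finite (F ` carrier G)"
    and "\<And>x y. x \<in> carrier G \<Longrightarrow> y \<in> carrier G \<Longrightarrow> F x = F y \<Longrightarrow> x \<otimes> inv y \<in> U"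
  shows "finite (rcosets U)"
proof -
  define r where "r z = U #> (SOME x. x \<in> carrier G \<and> F x = z)" for z
  have "rcosets U \<subseteq> r ` F ` carrier G"
  proof
    fix C assume "C \<in> rcosets U"
    then obtain x where x: "x \<in> carrier G" "C = U #> x" unfolding RCOSETS_def by auto
    let ?y = "SOME y. y \<in> carrier G \<and> F y = F x"
    have y: "?y \<in> carrier G \<and> F ?y = F x" by (rule someI[of _ x]) (use x in simp)
    have "C = r (F x)" unfolding r_def x(2)
      using rcos_eq_iff[OF assms(1) x(1), of ?y] assms(3)[OF x(1), of ?y] y by auto
    then show "C \<in> r ` F ` carrier G" using x by blast
  qed
  then show ?thesis using assms(2) finite_surj by blast
qed

lemma (in group) open_normal_Int:
  assumes "open_normal \<P> G U" "open_normal \<P> G V" "\<And>m n. m \<in> \<P> \<Longrightarrow> n \<in> \<P> \<Longrightarrow> m * n \<in> \<P>"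
  shows "open_normal \<P> G (U \<inter> V)"
proof -
  have U: "U \<lhd> G" "subgroup U G" and V: "V \<lhd> G" "subgroup V G"
    using assms(1,2) by (auto simp: open_normal_def normal_imp_subgroup)
  obtain d where d: "d \<in> \<P>" "\<And>x. x \<in> carrier G \<Longrightarrow> x [^] d \<in> U"
    using assms(1) by (auto simp: open_normal_def)
  obtain e where e: "e \<in> \<P>" "\<And>x. x \<in> carrier G \<Longrightarrow> x [^] e \<in> V"
    using assms(2) by (auto simp: open_normal_def)
  have UV: "U \<inter> V \<lhd> G" using normal_subgroup_intersect U V by blast
  have "(\<lambda>x. (U #> x, V #> x)) ` carrier G \<subseteq> (rcosets U) \<times> (rcosets V)"
    unfolding RCOSETS_def by auto
  moreover have "finite \<dots>" using assms(1,2) by (simp add: open_normal_def)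
  ultimately have "finite ((\<lambda>x. (U #> x, V #> x)) ` carrier G)" by (rule finite_subset)
  then have "finite (rcosets (U \<inter> V))"
    by (rule finite_rcosetsI[OF normal_imp_subgroup[OF UV]])
      (auto simp: rcos_eq_iff[OF U(2)] rcos_eq_iff[OF V(2)])
  moreover have "x [^] (d * e) \<in> U \<inter> V" if "x \<in> carrier G" for x
    using e(2)[of "x [^] d"] d(2)[of "x [^] e"] that by (simp add: nat_pow_pow mult.commute)
  ultimately show ?thesis unfolding open_normal_def using UV d e assms(3) by blast
qed

lemma (in group_hom) open_normal_vimage:
  assumes "open_normal \<P> H U"
  shows "open_normal \<P> G {x \<in> carrier G. h x \<in> U}"
proof -
  let ?V = "{x \<in> carrier G. h x \<in> U}"
  have U: "U \<lhd> H" using assms by (simp add: open_normal_def)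
  interpret U: normal U H by fact
  have sub: "subgroup ?V G"
    by (rule G.subgroupI) (auto intro: U.one_closed)
  have nor: "?V \<lhd> G"
    unfolding G.normal_inv_iff using sub U.inv_op_closed2 by auto
  have "(\<lambda>x. U #>\<^bsub>H\<^esub> h x) ` carrier G \<subseteq> rcosets\<^bsub>H\<^esub> U"
    unfolding RCOSETS_def using hom_closed by blast
  then have "finite ((\<lambda>x. U #>\<^bsub>H\<^esub> h x) ` carrier G)"
    using assms finite_subset unfolding open_normal_def by blast
  then have "finite (rcosets\<^bsub>G\<^esub> ?V)"
    by (rule G.finite_rcosetsI[OF sub]) (auto simp: H.rcos_eq_iff[OF U.subgroup_axioms])
  moreover obtain e where "e \<in> \<P>" "\<And>x. x \<in> carrier H \<Longrightarrow> x [^]\<^bsub>H\<^esub> e \<in> U"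
    using assms by (auto simp: open_normal_def)
  ultimately show ?thesis unfolding open_normal_def using nor
    by (auto simp: hom_nat_pow intro!: bexI[of _ e])
qed

lemma (in normal) rcos_image_iff:
  assumes "Y \<subseteq> carrier G" "g \<in> carrier G"
  shows "H #> g \<in> (\<lambda>y. H #> y) ` Y \<longleftrightarrow> (\<exists>y \<in> Y. g \<otimes> inv y \<in> H)"
  using rcos_eq_iff[OF subgroup_axioms assms(2)] assms(1) by auto

lemma (in normal) r_coset_epi_Mod: "(\<lambda>x. H #> x) \<in> epi G (G Mod H)"
  unfolding epi_def using r_coset_hom_Mod by (auto simp: carrier_FactGroup)

text \<open>By Lagrange the order of a finite group is an exponent of it, so the kernel of the given
  epimorphism is admissible.\<close>

lemma (in group) separableI_epi:
  assumes "subgroup Y G"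
    and "\<And>g. g \<in> carrier G - Y \<Longrightarrow> \<exists>(Q :: nat monoid) \<psi>. group Q \<and> finite (carrier Q) \<and>
      order Q \<in> \<P> \<and> \<psi> \<in> epi G Q \<and> \<psi> g \<notin> \<psi> ` Y"
  shows "separable \<P> Y G"
  unfolding separable_def
proof (intro conjI ballI)
  fix g assume g: "g \<in> carrier G - Y"
  from assms(2)[OF g] obtain Q :: "nat monoid" and \<psi> where Q: "group Q" "finite (carrier Q)"
    "order Q \<in> \<P>" "\<psi> \<in> epi G Q" "\<psi> g \<notin> \<psi> ` Y" by blast
  interpret Q: group Q by fact
  interpret \<psi>: group_hom G Q \<psi>
    using Q(4) by unfold_locales (simp add: epi_def)
  let ?U = "kernel G Q \<psi>"
  have "open_normal \<P> G ?U" unfolding open_normal_def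
  proof (intro conjI)
    show "?U \<lhd> G" by (rule \<psi>.normal_kernel)
    show "finite (rcosets ?U)"
    proof (rule finite_rcosetsI[OF \<psi>.subgroup_kernel])
      show "finite (\<psi> ` carrier G)" using Q by (simp add: epi_def)
    qed (auto simp: kernel_def)
    show "\<exists>e\<in>\<P>. \<forall>x\<in>carrier G. x [^] e \<in> ?U"
      using Q(3) Q.pow_order_eq_1 by (auto simp: kernel_def \<psi>.hom_nat_pow intro!: bexI[of _ "order Q"])
  qed
  moreover have "g \<otimes> inv y \<notin> ?U" if "y \<in> Y" for y
  proof
    assume "g \<otimes> inv y \<in> ?U"
    moreover have "y \<in> carrier G" using that assms(1) subgroup.mem_carrier by metis
    ultimately have "\<psi> g \<otimes>\<^bsub>Q\<^esub> inv\<^bsub>Q\<^esub> \<psi> y = \<one>\<^bsub>Q\<^esub>" using g by (simp add: kernel_def)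
    then have "\<psi> g = \<psi> y" using g \<open>y \<in> carrier G\<close> by (metis DiffD1 Q.inv_equality Q.inv_inv \<psi>.hom_closed Q.inv_closed)
    then show False using Q(5) that by blast
  qed
  ultimately show "\<exists>U. open_normal \<P> G U \<and> (\<forall>y\<in>Y. g \<otimes> inv y \<notin> U)" by blast
qed (fact assms(1))

lemma (in group) finitely_separable_iff: "finitely_separable Y G \<longleftrightarrow> separable {0<..} Y G"
proof
  assume "finitely_separable Y G"
  then show "separable {0<..} Y G"
    unfolding finitely_separable_def
    by (intro separableI_epi) (simp, metis greaterThan_iff group.is_monoid monoid.order_gt_0_iff_finite)
next
  assume sep: "separable {0<..} Y G"
  show "finitely_separable Y G"
  proof (rule finitely_separableI)
    show sub: "subgroup Y G" using sep by (simp add: separable_def)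
    fix g assume g: "g \<in> carrier G - Y"
    then obtain U where U: "open_normal {0<..} G U" "\<forall>y\<in>Y. g \<otimes> inv y \<notin> U"
      using sep by (auto simp: separable_def)
    interpret normal U G using U by (simp add: open_normal_def)
    show "\<exists>(Q :: 'a set monoid) \<psi>. group Q \<and> finite (carrier Q) \<and> \<psi> \<in> epi G Q \<and> \<psi> g \<notin> \<psi> ` Y"
      using U r_coset_epi_Mod factorgroup_is_group rcos_image_iff[OF subgroup.subset[OF sub], of g] g
      by (intro exI[of _ "G Mod U"] exI[of _ "\<lambda>x. U #> x"]) (auto simp: open_normal_def FactGroup_def)
  qed
qed

text \<open>By Cauchy's theorem a prime divisor of the order other than \<open>p\<close> would give
  an element whose order is that prime, contrary to the exponent.\<close>

lemma order_prime_power: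
  assumes "group Q" "finite (carrier Q)" "prime p"
    and "\<And>x. x \<in> carrier Q \<Longrightarrow> x [^]\<^bsub>Q\<^esub> (p ^ k :: nat) = \<one>\<^bsub>Q\<^esub>"
  shows "\<exists>n. order Q = p ^ n"
proof -
  interpret group Q by fact
  have pos: "order Q > 0" using assms(2) by (simp add: order_gt_0_iff_finite)
  then obtain m where m: "order Q = p ^ multiplicity p (order Q) * m" "\<not> p dvd m"
    using multiplicity_decompose'[of "order Q" p] assms(3) by (metis not_prime_unit less_numeral_extra(3))
  have "m = 1"
  proof (rule ccontr)
    assume "m \<noteq> 1"
    then obtain q where q: "prime q" "q dvd m" using prime_factor_nat by blast
    then have qp: "q \<noteq> p" using m(2) by auto
    have "q dvd order Q" using m(1) q(2) by (metis dvd_mult)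
    \<comment> \<open>Sylow's theorem for the first power of \<open>q\<close> supplies a subgroup of
      order \<open>q\<close>. A nontrivial element of it would have an order dividing both
      \<open>q\<close> and a power of \<open>p\<close>.\<close>
    then obtain r where "order Q = q ^ 1 * r" by auto
    then obtain S where S: "subgroup S Q" "card S = q"
      using sylow_thm[OF q(1) is_group _ assms(2), of 1 r] by auto
    have "S \<noteq> {\<one>\<^bsub>Q\<^esub>}" using S(2) q(1) prime_gt_1_nat by force
    then obtain x where x: "x \<in> S" "x \<noteq> \<one>\<^bsub>Q\<^esub>" using subgroup.one_closed[OF S(1)] by blast
    have xc: "x \<in> carrier Q" using x S subgroup.mem_carrier by metis
    interpret S: group "Q\<lparr>carrier := S\<rparr>" using S(1) subgroup_imp_group by blast
    have "finite S" using S(2) q(1) card_ge_0_finite prime_gt_0_nat by metis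
    then have "x [^]\<^bsub>Q\<lparr>carrier := S\<rparr>\<^esub> q = \<one>\<^bsub>Q\<^esub>"
      using S.pow_order_eq_1[of x] x S by (simp add: order_def)
    then have "x [^]\<^bsub>Q\<^esub> q = \<one>\<^bsub>Q\<^esub>" by (simp add: nat_pow_def)
    then have "ord x dvd q" "ord x dvd p ^ k" using assms(4)[OF xc] xc pow_eq_id by auto
    moreover have "coprime q (p ^ k)" using q(1) qp assms(3) primes_coprime by auto
    ultimately have "ord x = 1" by (metis coprime_common_divisor nat_dvd_1_iff_1)
    then show False using xc x ord_eq_1 by blast
  qed
  then show ?thesis using m(1) by auto
qed

lemma (in group) p_separable_iff:
  assumes "prime p"
  shows "p_separable p Y G \<longleftrightarrow> separable (range ((^) p)) Y G"
proof
  assume "p_separable p Y G"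
  then show "separable (range ((^) p)) Y G"
    unfolding p_separable_def finite_p_group_def
    by (intro separableI_epi) (auto, blast)
next
  assume sep: "separable (range ((^) p)) Y G"
  show "p_separable p Y G"
  proof (rule p_separableI)
    show sub: "subgroup Y G" using sep by (simp add: separable_def)
    fix g assume g: "g \<in> carrier G - Y"
    then obtain U where U: "open_normal (range ((^) p)) G U" "\<forall>y\<in>Y. g \<otimes> inv y \<notin> U"
      using sep by (auto simp: separable_def)
    interpret normal U G using U by (simp add: open_normal_def)
    obtain k where k: "\<And>x. x \<in> carrier G \<Longrightarrow> x [^] (p ^ k) \<in> U"
      using U(1) by (auto simp: open_normal_def)
    have fin: "finite (carrier (G Mod U))" using U(1) by (simp add: open_normal_def FactGroup_def)
    have "\<exists>n. order (G Mod U) = p ^ n"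
    proof (rule order_prime_power[OF factorgroup_is_group fin assms])
      fix x assume "x \<in> carrier (G Mod U)"
      then obtain g where g: "g \<in> carrier G" "x = U #> g" by (auto simp: carrier_FactGroup)
      show "x [^]\<^bsub>G Mod U\<^esub> (p ^ k) = \<one>\<^bsub>G Mod U\<^esub>"
        using FactGroup_pow[OF g(1)] k[OF g(1)] g(2) by (simp add: rcos_const[OF is_group])
    qed
    then show "\<exists>(Q :: 'a set monoid) \<psi>. finite_p_group p Q \<and> \<psi> \<in> epi G Q \<and> \<psi> g \<notin> \<psi> ` Y"
      using U r_coset_epi_Mod factorgroup_is_group fin rcos_image_iff[OF subgroup.subset[OF sub], of g] g
      by (intro exI[of _ "G Mod U"] exI[of _ "\<lambda>x. U #> x"]) (auto simp: finite_p_group_def)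
  qed
qed

lemma (in group) inv_cancel_left [simp]:
  assumes "x \<in> carrier G" "y \<in> carrier G"
  shows "inv x \<otimes> (x \<otimes> y) = y" "x \<otimes> (inv x \<otimes> y) = y"
  using assms by (simp_all flip: m_assoc)

text \<open>\<open>unbounded\<close> allows a nonzero integer to be detected modulo some exponent.
  \<open>split\<close> isolates the factor of an integer that is coprime to all exponents, which is
  the factor that an isolated subgroup can cancel.\<close>

locale exponents =
  fixes \<P> :: "nat set"
  assumes one_mem: "1 \<in> \<P>"
    and mult_mem: "m \<in> \<P> \<Longrightarrow> n \<in> \<P> \<Longrightarrow> m * n \<in> \<P>"
    and pos: "n \<in> \<P> \<Longrightarrow> n > 0"
    and unbounded: "\<exists>m \<in> \<P>. n < m"
    and split: "n > 0 \<Longrightarrow> \<exists>k \<in> \<P>. \<exists>n'. n = k * n' \<and> (\<forall>m \<in> \<P>. coprime n' m)"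

lemma exponents_positive: "exponents {0<..}"
proof
  fix n :: nat
  show "\<exists>m\<in>{0<..}. n < m" by (auto intro: bexI[of _ "Suc n"])
  show "\<exists>k\<in>{0<..}. \<exists>n'. n = k * n' \<and> (\<forall>m\<in>{0<..}. coprime n' m)" if "n > 0"
    using that by (intro bexI[of _ n] exI[of _ 1]) auto
qed auto

lemma exponents_prime_powers:
  assumes "prime (p :: nat)"
  shows "exponents (range ((^) p))"
proof
  show "1 \<in> range ((^) p)" by (metis power_0 rangeI)
  show "m * n \<in> range ((^) p)" if "m \<in> range ((^) p)" "n \<in> range ((^) p)" for m n
    using that by (auto simp flip: power_add)
  show "n > 0" if "n \<in> range ((^) p)" for n
    using that assms by (auto simp: prime_gt_0_nat)
  show "\<exists>m\<in>range ((^) p). n < m" for n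
    using power_gt_expt[of p n] prime_gt_1_nat[OF assms] by auto
  fix n :: nat assume "n > 0"
  then obtain n' where n': "n = p ^ multiplicity p n * n'" "\<not> p dvd n'"
    using multiplicity_decompose'[of n p] assms by (metis not_prime_unit less_numeral_extra(3))
  then have "coprime n' p" using assms by (metis coprime_commute prime_imp_coprime)
  then show "\<exists>k\<in>range ((^) p). \<exists>n'. n = k * n' \<and> (\<forall>m\<in>range ((^) p). coprime n' m)"
    using n'(1) by (intro bexI[of _ "p ^ multiplicity p n"] exI[of _ n']) auto
qed

context exponents
begin

lemma power_mem: "n \<in> \<P> \<Longrightarrow> n ^ k \<in> \<P>"
  by (induction k) (use one_mem mult_mem in auto)

text \<open>The degrees of the roots are the numbers coprime to every exponent: only 1 if \<P>
  contains all positive integers, and the numbers prime to p if \<P> consists of the powers of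
  p.\<close>

definition isolated :: "'a set \<Rightarrow> ('a, 'm) monoid_scheme \<Rightarrow> bool" where
  "isolated Y X \<longleftrightarrow> subgroup Y X \<and>
    (\<forall>g \<in> carrier X. \<forall>n::nat. (\<forall>m \<in> \<P>. coprime n m) \<longrightarrow> g [^]\<^bsub>X\<^esub> n \<in> Y \<longrightarrow> g \<in> Y)"

end

lemma (in group) isolated_positive_iff: "exponents.isolated {0<..} Y G \<longleftrightarrow> subgroup Y G"
proof -
  interpret exponents "{0<..}" by (rule exponents_positive)
  \<comment> \<open>Taking \<open>m = 2\<close> excludes \<open>n = 0\<close>, and taking
    \<open>m = n\<close> excludes \<open>n > 1\<close>.\<close>
  have "n = 1" if "\<forall>m\<in>{0<..}. coprime n m" for n :: nat
    using that[rule_format, of 2] that[rule_format, of n] by (cases "n = 0") auto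
  then show ?thesis unfolding isolated_def by (metis nat_pow_eone)
qed

text \<open>\<open>p'_isolated\<close> speaks of prime degrees only; a root of degree coprime to
  \<open>p\<close> is taken one prime factor at a time.\<close>

lemma (in group) isolated_prime_powers_iff:
  assumes "prime p"
  shows "exponents.isolated (range ((^) p)) Y G \<longleftrightarrow> p'_isolated p Y G"
proof -
  interpret exponents "range ((^) p)" using assms by (rule exponents_prime_powers)
  have "g \<in> Y" if iso: "p'_isolated p Y G" and "coprime n p" "g \<in> carrier G" "g [^] n \<in> Y" for g and n :: nat
    using that(2-)
  proof (induction n arbitrary: g rule: less_induct)
    case (less n)
    show ?case
    proof (cases "n = 1")
      case False
      then obtain q where q: "prime q" "q dvd n" using prime_factor_nat by blast
      then obtain k where k: "n = q * k" by auto
      have "q \<noteq> p" using q less.prems(1) by (metis coprime_absorb_left not_prime_unit coprime_divisors dvd_refl)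
      moreover have "n \<noteq> 0" using less.prems(1) assms by (metis coprime_0_left_iff not_prime_unit)
      ultimately have "k < n" using k q(1) prime_gt_1_nat[of q] by simp
      moreover have "coprime k p" using less.prems(1) k by simp
      moreover have "(g [^] k) [^] q \<in> Y" using less.prems k by (simp add: nat_pow_pow mult.commute)
      then have "g [^] k \<in> Y" using iso q(1) \<open>q \<noteq> p\<close> less.prems(2) unfolding p'_isolated_def by blast
      ultimately show ?thesis using less by blast
    qed (use less in simp)
  qed
  moreover have "coprime q m" if "prime q" "q \<noteq> p" "m \<in> range ((^) p)" for q m :: nat
    using that assms primes_coprime by auto
  moreover have "p \<in> range ((^) p)" by (metis power_one_right rangeI)
  ultimately show ?thesis unfolding isolated_def p'_isolated_def by meson
qed

section \<open>Separability of subgroups of a retract\<close>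

context exponents
begin

text \<open>If \<open>g\<close> lies in the retract, a subgroup of \<open>A\<close> that separates
  \<open>r g\<close> from \<open>Y\<close> is pulled back along \<open>r\<close>. Otherwise
  \<open>g\<close> differs from its projection \<open>i (r g)\<close>, and a \<open>U\<close>
  separating these two works after intersection with its preimage under
  \<open>i \<circ> r\<close>.\<close>

lemma separable_retract:
  assumes "group G" "group A" "i \<in> hom A G" "r \<in> hom G A"
    and ri: "\<And>a. a \<in> carrier A \<Longrightarrow> r (i a) = a"
    and res: "separable \<P> {\<one>\<^bsub>G\<^esub>} G" and sep: "separable \<P> Y A"
  shows "separable \<P> (i ` Y) G"
  unfolding separable_def
proof (intro conjI ballI)
  interpret G: group G by fact
  interpret A: group A by fact
  interpret i: group_hom A G i by unfold_locales fact
  interpret r: group_hom G A r by unfold_locales fact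
  have Y: "subgroup Y A" using sep by (simp add: separable_def)
  then show "subgroup (i ` Y) G" by (rule i.subgroup_img_is_subgroup)
  have Yc: "y \<in> carrier A" if "y \<in> Y" for y using that Y subgroup.mem_carrier by metis
  fix g assume "g \<in> carrier G - i ` Y"
  then have g: "g \<in> carrier G" "g \<notin> i ` Y" by auto
  show "\<exists>U. open_normal \<P> G U \<and> (\<forall>y\<in>i ` Y. g \<otimes>\<^bsub>G\<^esub> inv\<^bsub>G\<^esub> y \<notin> U)"
  proof (cases "i (r g) = g")
    case True
    then have "r g \<in> carrier A - Y" using g by force
    then obtain U where U: "open_normal \<P> A U" "\<forall>y\<in>Y. r g \<otimes>\<^bsub>A\<^esub> inv\<^bsub>A\<^esub> y \<notin> U"
      using sep unfolding separable_def by blast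
    show ?thesis
      using r.open_normal_vimage[OF U(1)] U(2) g Yc
      by (intro exI[of _ "{x \<in> carrier G. r x \<in> U}"]) (auto simp: ri)
  next
    case False
    let ?x = "g \<otimes>\<^bsub>G\<^esub> inv\<^bsub>G\<^esub> i (r g)"
    have "?x \<noteq> \<one>\<^bsub>G\<^esub>" using False g by (metis G.inv_equality G.inv_inv i.hom_closed r.hom_closed G.inv_closed)
    then obtain U where U: "open_normal \<P> G U" "?x \<notin> U"
      using res g unfolding separable_def by fastforce
    interpret U: normal U G using U by (simp add: open_normal_def)
    interpret ir: group_hom G G "i \<circ> r"
      by unfold_locales (rule hom_compose[OF assms(4,3)])
    let ?V = "{x \<in> carrier G. (i \<circ> r) x \<in> U}"
    have "g \<otimes>\<^bsub>G\<^esub> inv\<^bsub>G\<^esub> i y \<notin> U \<inter> ?V" if y: "y \<in> Y" for y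
    proof
      \<comment> \<open>Both \<open>g\<close> and \<open>i (r g)\<close> agree with
        \<open>i y\<close> modulo \<open>U\<close>, hence with each other.\<close>
      assume a: "g \<otimes>\<^bsub>G\<^esub> inv\<^bsub>G\<^esub> i y \<in> U \<inter> ?V"
      then have "i (r g) \<otimes>\<^bsub>G\<^esub> inv\<^bsub>G\<^esub> i y \<in> U" using g Yc[OF y] by (simp add: ri)
      then have "(g \<otimes>\<^bsub>G\<^esub> inv\<^bsub>G\<^esub> i y) \<otimes>\<^bsub>G\<^esub> inv\<^bsub>G\<^esub> (i (r g) \<otimes>\<^bsub>G\<^esub> inv\<^bsub>G\<^esub> i y) \<in> U"
        using U.m_closed[OF _ U.m_inv_closed] a by blast
      moreover have "(g \<otimes>\<^bsub>G\<^esub> inv\<^bsub>G\<^esub> i y) \<otimes>\<^bsub>G\<^esub> inv\<^bsub>G\<^esub> (i (r g) \<otimes>\<^bsub>G\<^esub> inv\<^bsub>G\<^esub> i y) = ?x"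
        using g Yc[OF y] by (simp add: G.inv_mult_group G.m_assoc)
      ultimately show False using U(2) by simp
    qed
    then show ?thesis
      using G.open_normal_Int[OF U(1) ir.open_normal_vimage[OF U(1)] mult_mem] by blast
  qed
qed

end

section \<open>Invariance under conjugation\<close>

lemma (in group) conj_in_normal_iff:
  assumes "U \<lhd> G" "x \<in> carrier G" "y \<in> carrier G"
  shows "inv x \<otimes> y \<otimes> x \<in> U \<longleftrightarrow> y \<in> U"
proof
  interpret U: normal U G by fact
  assume "inv x \<otimes> y \<otimes> x \<in> U"
  then have "x \<otimes> (inv x \<otimes> y \<otimes> x) \<otimes> inv x \<in> U" using U.inv_op_closed2 assms by blast
  moreover have "x \<otimes> (inv x \<otimes> y \<otimes> x) \<otimes> inv x = y" using assms by (simp add: m_assoc)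
  ultimately show "y \<in> U" by simp
next
  interpret U: normal U G by fact
  assume "y \<in> U"
  then show "inv x \<otimes> y \<otimes> x \<in> U" using U.inv_op_closed1 assms by blast
qed

lemma (in group) conj_hom:
  assumes "x \<in> carrier G"
  shows "(\<lambda>y. inv x \<otimes> y \<otimes> x) \<in> hom G G"
  using assms by (auto intro!: homI simp: m_assoc)

lemma (in group) conj_conj:
  assumes "x \<in> carrier G" "Y \<subseteq> carrier G" "Z = (\<lambda>y. inv x \<otimes> y \<otimes> x) ` Y"
  shows "Y = (\<lambda>y. inv (inv x) \<otimes> y \<otimes> inv x) ` Z"
proof -
  have "inv (inv x) \<otimes> (inv x \<otimes> y \<otimes> x) \<otimes> inv x = y" if "y \<in> Y" for y
    using that assms(1,2) by (simp add: m_assoc subset_iff)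
  then have "(\<lambda>y. inv (inv x) \<otimes> (inv x \<otimes> y \<otimes> x) \<otimes> inv x) ` Y = Y" by force
  then show ?thesis unfolding assms(3) image_image by simp
qed

lemma (in group) conjugate_in_sym:
  assumes "conjugate_in G Y Z" "Y \<subseteq> carrier G"
  shows "conjugate_in G Z Y"
  using assms conj_conj unfolding conjugate_in_def by (metis inv_closed)

lemma (in group) separable_conj:
  assumes "conjugate_in G Y Z" "separable \<P> Y G"
  shows "separable \<P> Z G"
  unfolding separable_def
proof (intro conjI ballI)
  obtain x where x: "x \<in> carrier G" "Z = (\<lambda>y. inv x \<otimes> y \<otimes> x) ` Y"
    using assms(1) by (auto simp: conjugate_in_def)
  interpret c: group_hom G G "\<lambda>y. inv x \<otimes> y \<otimes> x" by unfold_locales (rule conj_hom[OF x(1)])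
  have Y: "subgroup Y G" using assms(2) by (simp add: separable_def)
  then show "subgroup Z G" unfolding x(2) by (rule c.subgroup_img_is_subgroup)
  fix g assume "g \<in> carrier G - Z"
  then have g: "g \<in> carrier G" "g \<notin> Z" by auto
  let ?h = "x \<otimes> g \<otimes> inv x"
  have g_eq: "inv x \<otimes> ?h \<otimes> x = g" using g x(1) by (simp add: m_assoc)
  then have "?h \<in> carrier G - Y" using g x by force
  then obtain U where U: "open_normal \<P> G U" "\<forall>y\<in>Y. ?h \<otimes> inv y \<notin> U"
    using assms(2) unfolding separable_def by blast
  have "g \<otimes> inv (inv x \<otimes> y \<otimes> x) \<notin> U" if "y \<in> Y" for y
  proof -
    have y: "y \<in> carrier G" using that Y subgroup.mem_carrier by metis
    have "g \<otimes> inv (inv x \<otimes> y \<otimes> x) = inv x \<otimes> (?h \<otimes> inv y) \<otimes> x"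
      using g x(1) y by (simp add: m_assoc inv_mult_group)
    then show ?thesis
      using conj_in_normal_iff[of U x "?h \<otimes> inv y"] U that x(1) y g by (simp add: open_normal_def)
  qed
  then show "\<exists>U. open_normal \<P> G U \<and> (\<forall>y\<in>Z. g \<otimes> inv y \<notin> U)" using U(1) x(2) by blast
qed

lemma (in exponents) isolated_conj:
  assumes "group G" "conjugate_in G Y Z" "isolated Y G"
  shows "isolated Z G"
proof -
  interpret group G by fact
  obtain x where x: "x \<in> carrier G" "Z = (\<lambda>y. inv\<^bsub>G\<^esub> x \<otimes>\<^bsub>G\<^esub> y \<otimes>\<^bsub>G\<^esub> x) ` Y"
    using assms(2) by (auto simp: conjugate_in_def)
  interpret c: group_hom G G "\<lambda>y. inv\<^bsub>G\<^esub> x \<otimes>\<^bsub>G\<^esub> y \<otimes>\<^bsub>G\<^esub> x" by unfold_locales (rule conj_hom[OF x(1)])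
  interpret d: group_hom G G "\<lambda>y. inv\<^bsub>G\<^esub> (inv\<^bsub>G\<^esub> x) \<otimes>\<^bsub>G\<^esub> y \<otimes>\<^bsub>G\<^esub> inv\<^bsub>G\<^esub> x"
    by unfold_locales (rule conj_hom[OF inv_closed[OF x(1)]])
  have Y: "subgroup Y G" using assms(3) by (simp add: isolated_def)
  have YZ: "Y = (\<lambda>y. inv\<^bsub>G\<^esub> (inv\<^bsub>G\<^esub> x) \<otimes>\<^bsub>G\<^esub> y \<otimes>\<^bsub>G\<^esub> inv\<^bsub>G\<^esub> x) ` Z"
    by (rule conj_conj[OF x(1) subgroup.subset[OF Y] x(2)])
  have "g \<in> Z" if g: "g \<in> carrier G" "\<forall>m\<in>\<P>. coprime n m" "g [^]\<^bsub>G\<^esub> n \<in> Z" for g and n :: nat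
  proof -
    let ?h = "inv\<^bsub>G\<^esub> (inv\<^bsub>G\<^esub> x) \<otimes>\<^bsub>G\<^esub> g \<otimes>\<^bsub>G\<^esub> inv\<^bsub>G\<^esub> x"
    have "?h [^]\<^bsub>G\<^esub> n \<in> Y" unfolding YZ d.hom_nat_pow[OF g(1), symmetric] using g(3) by blast
    then have "?h \<in> Y" using assms(3) g d.hom_closed unfolding isolated_def by blast
    moreover have "inv\<^bsub>G\<^esub> x \<otimes>\<^bsub>G\<^esub> ?h \<otimes>\<^bsub>G\<^esub> x = g"
      using g(1) x(1) by (simp add: m_assoc)
    ultimately show ?thesis unfolding x(2) by (metis imageI)
  qed
  then show ?thesis unfolding isolated_def x(2)
    using c.subgroup_img_is_subgroup[OF Y] by blast
qed

section \<open>Unipotent representations of an amalgam\<close>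

text \<open>The multiplication is reversed because an operator that substitutes into the arguments of a
  function, such as \<open>shift_op\<close> below, depends contravariantly on the substitution.\<close>

definition op_bij_group :: "('x \<Rightarrow> 'x) monoid" where
  "op_bij_group = \<lparr>carrier = {f. bij f}, mult = (\<lambda>f g. g \<circ> f), one = id\<rparr>"

lemma group_op_bij_group: "group op_bij_group"
proof (rule groupI)
  fix f :: "'x \<Rightarrow> 'x" assume "f \<in> carrier op_bij_group"
  then show "\<exists>g\<in>carrier op_bij_group. g \<otimes>\<^bsub>op_bij_group\<^esub> f = \<one>\<^bsub>op_bij_group\<^esub>"
    by (intro bexI[of _ "inv_into UNIV f"])
      (auto simp: op_bij_group_def bij_imp_bij_inv simp flip: surj_iff dest: bij_is_surj)
qed (auto simp: op_bij_group_def bij_comp comp_assoc)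

text \<open>Extended by the identity outside the carrier, so that \<open>lmult\<close> is multiplicative on the whole
  type.\<close>

definition lmult :: "('c, 'm) monoid_scheme \<Rightarrow> 'c \<Rightarrow> 'c \<Rightarrow> 'c" where
  "lmult P x y = (if y \<in> carrier P then x \<otimes>\<^bsub>P\<^esub> y else y)"

lemma (in group) lmult_mult:
  "x \<in> carrier G \<Longrightarrow> y \<in> carrier G \<Longrightarrow> lmult G (x \<otimes> y) = lmult G x \<circ> lmult G y"
  by (auto simp: lmult_def m_assoc)

lemma (in group) lmult_one: "lmult G \<one> = id"
  by (auto simp: lmult_def)

lemma (in group) lmult_closed: "x \<in> carrier G \<Longrightarrow> y \<in> carrier G \<Longrightarrow> lmult G x y \<in> carrier G"
  by (simp add: lmult_def)

text \<open>The term with \<open>\<chi>\<close> is a coboundary, which makes the operators multiplicative; it vanishes for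
  elements that leave \<open>\<chi>\<close> invariant, so the operators of both factors agree on the amalgamated
  subgroup when \<open>\<chi>\<close> is its indicator function.\<close>

definition shift_op ::
  "(nat \<Rightarrow> bool) \<Rightarrow> ('c \<Rightarrow> int) \<Rightarrow> ('c \<Rightarrow> 'c) \<Rightarrow> ('c \<Rightarrow> 'c) \<Rightarrow> ('c list \<Rightarrow> int) \<Rightarrow> 'c list \<Rightarrow> int" where
  "shift_op E \<chi> \<sigma> \<tau> v l = (case l of [] \<Rightarrow> v [] | x # w \<Rightarrow>
    if E (length w) then v (\<sigma> x # map \<tau> w) + (\<chi> (\<sigma> x) - \<chi> x) * v (map \<tau> w)
    else v (map \<tau> l))"

lemma shift_op_Nil [simp]: "shift_op E \<chi> \<sigma> \<tau> v [] = v []"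
  by (simp add: shift_op_def)

lemma shift_op_Cons [simp]: "shift_op E \<chi> \<sigma> \<tau> v (x # w) =
    (if E (length w) then v (\<sigma> x # map \<tau> w) + (\<chi> (\<sigma> x) - \<chi> x) * v (map \<tau> w)
    else v (\<tau> x # map \<tau> w))"
  by (simp add: shift_op_def)

text \<open>If the length of \<open>w\<close> satisfies \<open>E\<close>, the tail of
  \<open>w\<close> has a length of the other parity, so the operator acts on \<open>w\<close>
  through \<open>\<tau>\<close> alone. The coefficients of the value at the tail then telescope:
  \<open>\<chi> (\<sigma> (\<sigma>' x)) - \<chi> (\<sigma>' x)\<close> plus
  \<open>\<chi> (\<sigma>' x) - \<chi> x\<close>.\<close>

lemma shift_op_comp:
  assumes "\<And>n. E (Suc n) \<longleftrightarrow> \<not> E n"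
  shows "shift_op E \<chi> \<sigma>' \<tau>' \<circ> shift_op E \<chi> \<sigma> \<tau> = shift_op E \<chi> (\<sigma> \<circ> \<sigma>') (\<tau> \<circ> \<tau>')"
proof (intro ext)
  fix v l
  have map: "shift_op E \<chi> \<sigma> \<tau> v (map \<tau>' w) = v (map (\<tau> \<circ> \<tau>') w)" if "E (length w)" for w
    using that assms by (cases w) auto
  show "(shift_op E \<chi> \<sigma>' \<tau>' \<circ> shift_op E \<chi> \<sigma> \<tau>) v l = shift_op E \<chi> (\<sigma> \<circ> \<sigma>') (\<tau> \<circ> \<tau>') v l"
    by (cases l) (auto simp: map algebra_simps)
qed

lemma shift_op_id: "shift_op E \<chi> id id = id"
proof (intro ext)
  show "shift_op E \<chi> id id v l = id v l" for v l by (cases l) auto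
qed

text \<open>This is the situation of the amalgamated subgroup, where the operator becomes
  independent of the parity \<open>E\<close>.\<close>

lemma shift_op_invariant:
  assumes "\<And>x. \<chi> (\<sigma> x) = \<chi> x"
  shows "shift_op E \<chi> \<sigma> \<sigma> v l = v (map \<sigma> l)"
  using assms by (cases l) auto

lemma shift_op_linear:
  "shift_op E \<chi> \<sigma> \<tau> (\<lambda>l. a * v l + b * w l) =
    (\<lambda>l. a * shift_op E \<chi> \<sigma> \<tau> v l + b * shift_op E \<chi> \<sigma> \<tau> w l)"
proof
  show "shift_op E \<chi> \<sigma> \<tau> (\<lambda>l. a * v l + b * w l) l =
      a * shift_op E \<chi> \<sigma> \<tau> v l + b * shift_op E \<chi> \<sigma> \<tau> w l" for l
    by (cases l) (auto simp: algebra_simps)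
qed

lemma shift_op_hom:
  assumes P: "group P" and A: "group A" and q: "q \<in> hom A P" and r: "r \<in> hom A P"
    and E: "\<And>n. E (Suc n) \<longleftrightarrow> \<not> E n"
  shows "(\<lambda>a. shift_op E \<chi> (lmult P (q a)) (lmult P (r a))) \<in> hom A op_bij_group"
proof -
  interpret P: group P by fact
  interpret A: group A by fact
  interpret q: group_hom A P q using q by unfold_locales
  interpret r: group_hom A P r using r by unfold_locales
  let ?S = "\<lambda>a. shift_op E \<chi> (lmult P (q a)) (lmult P (r a))"
  have mult: "?S (a \<otimes>\<^bsub>A\<^esub> b) = ?S b \<circ> ?S a" if "a \<in> carrier A" "b \<in> carrier A" for a b
    using that by (simp add: shift_op_comp[of E, OF E] P.lmult_mult)
  have one: "?S \<one>\<^bsub>A\<^esub> = id" by (simp add: P.lmult_one shift_op_id)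
  have "bij (?S a)" if "a \<in> carrier A" for a
    by (rule o_bij[of "?S (inv\<^bsub>A\<^esub> a)"]) (use that in \<open>simp_all only: mult[symmetric] A.inv_closed A.l_inv A.r_inv one\<close>)
  then show ?thesis by (intro homI) (simp_all add: op_bij_group_def mult del: q.hom_mult r.hom_mult)
qed

text \<open>The universal property of the amalgam is only required for the one target group needed below,
  as HOL cannot quantify over types in a locale assumption.\<close>

locale amalgamated_retracts = group G for G (structure) +
  fixes A B H :: "'a set" and \<pi>A \<pi>B \<rho> :: "'a \<Rightarrow> 'a"
  assumes sub: "subgroup A G" "subgroup B G" "subgroup H G" and HA: "H \<subseteq> A" and HB: "H \<subseteq> B"
    and gen: "generate G (A \<union> B) = carrier G"
    and \<pi>A: "\<pi>A \<in> hom G G" "\<And>a. a \<in> A \<Longrightarrow> \<pi>A a = a" "\<And>b. b \<in> B \<Longrightarrow> \<pi>A b = \<rho> b"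
    and \<pi>B: "\<pi>B \<in> hom G G" "\<And>b. b \<in> B \<Longrightarrow> \<pi>B b = b" "\<And>a. a \<in> A \<Longrightarrow> \<pi>B a = \<rho> a"
    and \<rho>: "\<rho> \<in> hom G G" "\<And>g. g \<in> carrier G \<Longrightarrow> \<rho> g \<in> H" "\<And>h. h \<in> H \<Longrightarrow> \<rho> h = h"
    and lift: "\<And>f g. f \<in> hom (G\<lparr>carrier := A\<rparr>) (op_bij_group :: (('a set list \<Rightarrow> int) \<Rightarrow> _) monoid) \<Longrightarrow>
      g \<in> hom (G\<lparr>carrier := B\<rparr>) op_bij_group \<Longrightarrow> (\<And>h. h \<in> H \<Longrightarrow> f h = g h) \<Longrightarrow>
      \<exists>k \<in> hom G op_bij_group. (\<forall>a\<in>A. k a = f a) \<and> (\<forall>b\<in>B. k b = g b)"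
begin

lemma AB_carrier: "x \<in> A \<Longrightarrow> x \<in> carrier G" "x \<in> B \<Longrightarrow> x \<in> carrier G" "x \<in> H \<Longrightarrow> x \<in> carrier G"
  by (rule subgroup.mem_carrier[OF sub(1)], assumption, rule subgroup.mem_carrier[OF sub(2)], assumption,
      rule subgroup.mem_carrier[OF sub(3)], assumption)

text \<open>\<open>A\<close> and \<open>B\<close> are subgroups, so the inverse of a generator is a
  generator and inversion has no case of its own.\<close>

lemma gen_induct [consumes 1, case_names one A B mult]:
  assumes "g \<in> carrier G" "Q \<one>" "\<And>a. a \<in> A \<Longrightarrow> Q a" "\<And>b. b \<in> B \<Longrightarrow> Q b"
    and "\<And>x y. x \<in> carrier G \<Longrightarrow> y \<in> carrier G \<Longrightarrow> Q x \<Longrightarrow> Q y \<Longrightarrow> Q (x \<otimes> y)"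
  shows "Q g"
proof -
  have "g \<in> generate G (A \<union> B)" using assms(1) by (simp only: gen)
  then show ?thesis
  proof (induction rule: generate.induct)
    case one
    show ?case by (rule assms(2))
  next
    case (incl h)
    then show ?case by (elim UnE) (rule assms(3), assumption, rule assms(4), assumption)
  next
    case (inv h)
    then have "inv h \<in> A \<or> inv h \<in> B"
      using subgroup.m_inv_closed[OF sub(1)] subgroup.m_inv_closed[OF sub(2)] by blast
    then show ?case by (elim disjE) (rule assms(3), assumption, rule assms(4), assumption)
  next
    case (eng x y)
    have "x \<in> carrier G" "y \<in> carrier G" using eng.hyps by (simp_all only: gen)
    then show ?case using eng.IH by (rule assms(5))
  qed
qed

end

text \<open>The flag \<open>s\<close> decides which factor feeds at tails of even length:
  \<open>A\<close> if \<open>s\<close> holds and \<open>B\<close> otherwise. An alternating product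
  that starts in that factor lengthens the support of the basis vector of the empty word with each
  letter.\<close>

locale amalgam_rep = amalgamated_retracts + P: group P for P :: "'c monoid" +
  fixes q :: "'a \<Rightarrow> 'c" and s :: bool and \<Psi> :: "'a \<Rightarrow> ('c list \<Rightarrow> int) \<Rightarrow> 'c list \<Rightarrow> int"
  assumes q: "q \<in> hom G P"
    and \<Psi>_one: "\<Psi> \<one> = id"
    and \<Psi>_mult: "x \<in> carrier G \<Longrightarrow> y \<in> carrier G \<Longrightarrow> \<Psi> (x \<otimes> y) = \<Psi> y \<circ> \<Psi> x"
    and \<Psi>_A: "a \<in> A \<Longrightarrow> \<Psi> a = shift_op (\<lambda>n. even n = s) (\<lambda>x. if x \<in> q ` H then 1 else 0)
        (lmult P (q a)) (lmult P (q (\<rho> a)))"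
    and \<Psi>_B: "b \<in> B \<Longrightarrow> \<Psi> b = shift_op (\<lambda>n. even n \<noteq> s) (\<lambda>x. if x \<in> q ` H then 1 else 0)
        (lmult P (q b)) (lmult P (q (\<rho> b)))"
begin

sublocale q: group_hom G P q
  by unfold_locales (rule q)

lemma \<Psi>_inv:
  assumes "x \<in> carrier G"
  shows "\<Psi> (inv x) (\<Psi> x v) = v" "\<Psi> x (\<Psi> (inv x) v) = v"
proof -
  have "\<Psi> (inv x) \<circ> \<Psi> x = id" "\<Psi> x \<circ> \<Psi> (inv x) = id"
    using assms \<Psi>_mult[of x "inv x"] \<Psi>_mult[of "inv x" x] by (simp_all add: \<Psi>_one)
  then show "\<Psi> (inv x) (\<Psi> x v) = v" "\<Psi> x (\<Psi> (inv x) v) = v"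
    by (simp_all add: pointfree_idE)
qed

lemma \<Psi>_linear:
  assumes "g \<in> carrier G"
  shows "\<Psi> g (\<lambda>l. a * v l + b * w l) = (\<lambda>l. a * \<Psi> g v l + b * \<Psi> g w l)"
  using assms
proof (induction g arbitrary: v w rule: gen_induct)
  case one
  show ?case by (simp only: \<Psi>_one id_apply)
next
  case (A x)
  then show ?case by (simp only: \<Psi>_A shift_op_linear)
next
  case (B x)
  then show ?case by (simp only: \<Psi>_B shift_op_linear)
next
  case (mult x y)
  show ?case by (simp only: \<Psi>_mult[OF mult.hyps] comp_apply mult.IH)
qed

lemma \<Psi>_diff: "g \<in> carrier G \<Longrightarrow> \<Psi> g (\<lambda>l. v l - w l) = (\<lambda>l. \<Psi> g v l - \<Psi> g w l)"
  using \<Psi>_linear[of g 1 v "-1" w] by simp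

lemma \<Psi>_Nil: "g \<in> carrier G \<Longrightarrow> \<Psi> g v [] = v []"
  by (induction g arbitrary: v rule: gen_induct) (simp_all add: \<Psi>_one \<Psi>_mult \<Psi>_A \<Psi>_B)

section \<open>The filtration of functions by word length\<close>

definition words :: "'c list set" where "words = lists (carrier P)"

text \<open>For \<open>N = 0\<close> this is vanishing on the nose, since \<open>0\<close> divides only \<open>0\<close>.\<close>

definition vanishes :: "int \<Rightarrow> nat \<Rightarrow> ('c list \<Rightarrow> int) \<Rightarrow> bool" where
  "vanishes N k v \<longleftrightarrow> (\<forall>l \<in> words. length l < k \<longrightarrow> N dvd v l)"

lemma vanishes_mono: "vanishes N k v \<Longrightarrow> j \<le> k \<Longrightarrow> vanishes N j v"
  unfolding vanishes_def by auto

lemma vanishes_linear: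
  "vanishes N k v \<Longrightarrow> vanishes N k w \<Longrightarrow> vanishes N k (\<lambda>l. a * v l + b * w l)"
  unfolding vanishes_def by simp

lemma vanishes_add: "vanishes N k v \<Longrightarrow> vanishes N k w \<Longrightarrow> vanishes N k (\<lambda>l. v l + w l)"
  unfolding vanishes_def by simp

lemma lmult_words: "x \<in> carrier P \<Longrightarrow> w \<in> words \<Longrightarrow> map (lmult P x) w \<in> words"
  by (auto simp: words_def P.lmult_closed)

text \<open>The value of the new function at a word involves only values of \<open>v\<close> at
  words of the same length or one less.\<close>

lemma vanishes_shift_op:
  assumes "x \<in> carrier P" "y \<in> carrier P" "vanishes N k v"
  shows "vanishes N k (shift_op E \<chi> (lmult P x) (lmult P y) v)"
  unfolding vanishes_def
proof (intro ballI impI)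
  fix l assume l: "l \<in> words" "length l < k"
  show "N dvd shift_op E \<chi> (lmult P x) (lmult P y) v l"
  proof (cases l)
    case Nil
    then show ?thesis using assms(3) l by (simp add: vanishes_def)
  next
    case (Cons z w)
    then have z: "lmult P x z \<in> carrier P" "lmult P y z \<in> carrier P" and w: "map (lmult P y) w \<in> words"
      using l assms lmult_words by (auto simp: words_def P.lmult_closed)
    then have "lmult P x z # map (lmult P y) w \<in> words" "lmult P y z # map (lmult P y) w \<in> words"
      by (auto simp: words_def)
    then show ?thesis using assms(3) l w Cons unfolding vanishes_def by auto
  qed
qed

lemma vanishes_\<Psi>: "g \<in> carrier G \<Longrightarrow> vanishes N k v \<Longrightarrow> vanishes N k (\<Psi> g v)"
proof (induction g arbitrary: v rule: gen_induct)
  case (A a)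
  then show ?case
    using \<rho>(2) AB_carrier by (auto simp: \<Psi>_A intro!: vanishes_shift_op)
next
  case (B b)
  then show ?case
    using \<rho>(2) AB_carrier by (auto simp: \<Psi>_B intro!: vanishes_shift_op)
qed (simp_all add: \<Psi>_one \<Psi>_mult)

text \<open>On words of length \<open>k\<close> this is the permutation through which \<open>\<Psi> g\<close> acts on the functions that
  vanish below length \<open>k\<close>, modulo those that vanish at length \<open>k\<close> as well.\<close>

definition graded :: "'a \<Rightarrow> 'c list \<Rightarrow> 'c list" where
  "graded g l = (case l of [] \<Rightarrow> [] | x # w \<Rightarrow>
    lmult P (q ((if even (length w) = s then \<pi>A else \<pi>B) g)) x # map (lmult P (q (\<rho> g))) w)"

lemma length_graded [simp]: "length (graded g l) = length l"
  by (simp add: graded_def split: list.split)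

lemma hom_carrier: "g \<in> carrier G \<Longrightarrow> \<pi>A g \<in> carrier G \<and> \<pi>B g \<in> carrier G \<and> \<rho> g \<in> carrier G"
  using \<pi>A(1) \<pi>B(1) \<rho>(1) by (auto simp: hom_def)

lemma graded_words: "g \<in> carrier G \<Longrightarrow> l \<in> words \<Longrightarrow> graded g l \<in> words"
  using hom_carrier by (auto simp: graded_def words_def P.lmult_closed split: list.split)

lemma graded_mult:
  assumes "x \<in> carrier G" "y \<in> carrier G"
  shows "graded (x \<otimes> y) l = graded x (graded y l)"
  using assms hom_carrier hom_mult[OF \<pi>A(1)] hom_mult[OF \<pi>B(1)] hom_mult[OF \<rho>(1)]
  by (auto simp: graded_def P.lmult_mult split: list.split)

text \<open>The feeding term reads \<open>v\<close> at a word shorter by one, where it is divisible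
  by \<open>N\<close>, so only the substitution into the letters survives. The head is moved by
  \<open>\<pi>A\<close> or \<open>\<pi>B\<close> since each is the identity on its own factor and
  \<open>\<rho>\<close> on the other.\<close>

lemma \<Psi>_graded:
  assumes "g \<in> carrier G" "vanishes N k v" "l \<in> words" "length l = k"
  shows "N dvd \<Psi> g v l - v (graded g l)"
  using assms
proof (induction g arbitrary: v l rule: gen_induct)
  case one
  have "\<pi>A \<one> = \<one>" "\<pi>B \<one> = \<one>" "\<rho> \<one> = \<one>"
    using \<pi>A(1) \<pi>B(1) \<rho>(1) by (simp_all add: hom_one[OF _ is_group is_group])
  then have "graded \<one> l = l"
    by (simp add: graded_def P.lmult_one split: list.split)
  then show ?case by (simp add: \<Psi>_one)
next
  case (A a)
  have c: "q (\<rho> a) \<in> carrier P" using A \<rho>(2) AB_carrier q.hom_closed by blast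
  show ?case
  proof (cases l)
    case (Cons x w)
    then have "map (lmult P (q (\<rho> a))) w \<in> words" "length w < k" using A c lmult_words by (auto simp: words_def)
    then have "N dvd v (map (lmult P (q (\<rho> a))) w)" using A(2) by (simp add: vanishes_def)
    then show ?thesis using A(1) Cons by (auto simp: \<Psi>_A graded_def \<pi>A \<pi>B)
  qed (use A in \<open>simp add: \<Psi>_A graded_def\<close>)
next
  case (B a)
  have c: "q (\<rho> a) \<in> carrier P" using B \<rho>(2) AB_carrier q.hom_closed by blast
  show ?case
  proof (cases l)
    case (Cons x w)
    then have "map (lmult P (q (\<rho> a))) w \<in> words" "length w < k" using B c lmult_words by (auto simp: words_def)
    then have "N dvd v (map (lmult P (q (\<rho> a))) w)" using B(2) by (simp add: vanishes_def)
    then show ?thesis using B(1) Cons by (auto simp: \<Psi>_B graded_def \<pi>A \<pi>B)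
  qed (use B in \<open>simp add: \<Psi>_B graded_def\<close>)
next
  case (mult x y)
  have "N dvd \<Psi> y (\<Psi> x v) l - \<Psi> x v (graded y l)"
    using mult.IH(2)[OF vanishes_\<Psi>[OF mult.hyps(1) mult.prems(1)]] mult.prems by blast
  moreover have "N dvd \<Psi> x v (graded y l) - v (graded x (graded y l))"
    using mult.IH(1)[OF mult.prems(1)] mult.prems graded_words[OF mult.hyps(2)] by simp
  ultimately have "N dvd (\<Psi> y (\<Psi> x v) l - \<Psi> x v (graded y l)) + (\<Psi> x v (graded y l) - v (graded x (graded y l)))"
    by (rule dvd_add)
  then show ?case using mult by (simp add: \<Psi>_mult graded_mult)
qed

section \<open>Unipotent elements and the expansion of their powers\<close>

definition unipotent :: "'a \<Rightarrow> bool" where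
  "unipotent g \<longleftrightarrow> g \<in> carrier G \<and>
    (\<forall>N k v. vanishes N k v \<longrightarrow> vanishes N (Suc k) (\<lambda>l. \<Psi> g v l - v l))"

text \<open>As \<open>e\<close> is an exponent of \<open>P\<close>, the images of the
  \<open>e\<close>-th power under \<open>\<pi>A\<close>, \<open>\<pi>B\<close> and
  \<open>\<rho>\<close> are all killed by \<open>q\<close>. Its permutation of words is trivial, so
  modulo \<open>N\<close> the lowest layer of a function stays fixed.\<close>

lemma unipotent_pow:
  assumes "g \<in> carrier G" "\<And>y. y \<in> carrier P \<Longrightarrow> y [^]\<^bsub>P\<^esub> (e::nat) = \<one>\<^bsub>P\<^esub>"
  shows "unipotent (g [^] e)"
proof -
  have "q (f (g [^] e)) = \<one>\<^bsub>P\<^esub>" if "f \<in> hom G G" for f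
  proof -
    interpret f: group_hom G G f using that by unfold_locales
    show ?thesis using assms by (simp add: f.hom_nat_pow q.hom_nat_pow)
  qed
  then have "graded (g [^] e) l = l" for l
    using \<pi>A(1) \<pi>B(1) \<rho>(1) by (simp add: graded_def P.lmult_one split: list.split)
  then have "vanishes N (Suc k) (\<lambda>l. \<Psi> (g [^] e) v l - v l)" if "vanishes N k v" for N k v
    unfolding vanishes_def using \<Psi>_graded[of "g [^] e" N k v] vanishes_\<Psi>[of "g [^] e" N k v] assms(1) that
    by (auto simp: vanishes_def less_Suc_eq)
  then show ?thesis using assms(1) by (simp add: unipotent_def)
qed

lemma vanishes_commute: "vanishes N k (\<lambda>l. v l - w l) \<Longrightarrow> vanishes N k (\<lambda>l. w l - v l)"
  unfolding vanishes_def by (metis dvd_minus_iff minus_diff_eq)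

text \<open>Write D for \<open>\<Psi> g\<close> minus the identity. By hypothesis D applied twice to
  \<open>v\<close> vanishes below length \<open>j\<close>, so there the binomial expansion of the
  \<open>i\<close>-th power of 1 + D stops after the linear term.\<close>

lemma \<Psi>_pow_expansion:
  assumes g: "g \<in> carrier G" and van: "vanishes N j (\<lambda>l. \<Psi> g w l - w l)"
    and w: "w = (\<lambda>l. \<Psi> g v l - v l)"
  shows "vanishes N j (\<lambda>l. \<Psi> (g [^] (i::nat)) v l - v l - int i * w l)"
proof (induction i)
  case 0
  then show ?case by (simp add: \<Psi>_one vanishes_def)
next
  case (Suc i)
  \<comment> \<open>\<open>d\<close> is the error of the expansion at stage \<open>i\<close> and
    \<open>f\<close> the total change of \<open>v\<close>; by linearity the next stage only involves
    \<open>\<Psi> g w\<close> and \<open>\<Psi> g d\<close>.\<close>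
  define d where "d = (\<lambda>l. \<Psi> (g [^] i) v l - v l - int i * w l)"
  define f where "f = (\<lambda>l. int i * w l + 1 * d l)"
  have "\<Psi> (g [^] i) v = (\<lambda>l. 1 * v l + 1 * f l)" by (auto simp: f_def d_def)
  then have "\<Psi> g (\<Psi> (g [^] i) v) = (\<lambda>l. 1 * \<Psi> g v l + 1 * \<Psi> g f l)"
    by (simp only: \<Psi>_linear[OF g])
  also have "\<Psi> g f = (\<lambda>l. int i * \<Psi> g w l + 1 * \<Psi> g d l)"
    unfolding f_def by (rule \<Psi>_linear[OF g])
  finally have "(\<lambda>l. \<Psi> (g [^] Suc i) v l - v l - int (Suc i) * w l) =
      (\<lambda>l. int i * (\<Psi> g w l - w l) + 1 * \<Psi> g d l)"
    using g by (simp add: \<Psi>_mult w algebra_simps)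
  moreover have "vanishes N j (\<Psi> g d)" using vanishes_\<Psi>[OF g Suc.IH] by (simp add: d_def)
  ultimately show ?case using vanishes_linear[OF van, of _ "int i" 1] by simp
qed

lemma unipotent_inv:
  assumes "unipotent u"
  shows "unipotent (inv u)"
  unfolding unipotent_def
proof (intro conjI allI impI)
  have u: "u \<in> carrier G" using assms by (simp add: unipotent_def)
  then show "inv u \<in> carrier G" by simp
  fix N k v assume "vanishes N k v"
  then have "vanishes N (Suc k) (\<lambda>l. \<Psi> u v l - v l)" using assms by (simp add: unipotent_def)
  then have "vanishes N (Suc k) (\<Psi> (inv u) (\<lambda>l. \<Psi> u v l - v l))" using u vanishes_\<Psi> by blast
  then have "vanishes N (Suc k) (\<lambda>l. v l - \<Psi> (inv u) v l)" using u by (simp add: \<Psi>_diff \<Psi>_inv)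
  then show "vanishes N (Suc k) (\<lambda>l. \<Psi> (inv u) v l - v l)"
    by (rule vanishes_commute)
qed

text \<open>For negative \<open>j\<close> the expansion is applied to \<open>inv u\<close>, whose
  linear term is \<open>- w\<close> up to length \<open>k\<close>.\<close>

lemma unipotent_int_pow_expansion:
  assumes u: "unipotent u" and w: "w = (\<lambda>l. \<Psi> u v l - v l)" and van: "vanishes N k w"
  shows "vanishes N (Suc k) (\<lambda>l. \<Psi> (u [^] (j::int)) v l - v l - j * w l)"
proof -
  have uc: "u \<in> carrier G" using u by (simp add: unipotent_def)
  have pos: "vanishes N (Suc k) (\<lambda>l. \<Psi> (u [^] i) v l - v l - int i * w l)" for i :: nat
    by (rule \<Psi>_pow_expansion[OF uc _ w]) (use u van in \<open>simp add: unipotent_def\<close>)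
  let ?w = "\<lambda>l. \<Psi> (inv u) v l - v l"
  have ui: "unipotent (inv u)" by (rule unipotent_inv[OF u])
  have w_eq: "\<Psi> (inv u) v l - v l = - \<Psi> (inv u) w l" for l
    unfolding w \<Psi>_diff[OF inv_closed[OF uc]] \<Psi>_inv[OF uc] by (rule minus_diff_eq[symmetric])
  have "vanishes N k ?w"
    unfolding w_eq using vanishes_\<Psi>[OF inv_closed[OF uc] van] by (simp add: vanishes_def)
  then have neg: "vanishes N (Suc k) (\<lambda>l. \<Psi> ((inv u) [^] i) v l - v l - int i * ?w l)" for i :: nat
    by (intro \<Psi>_pow_expansion[OF inv_closed[OF uc] _ HOL.refl]) (use ui in \<open>simp add: unipotent_def\<close>)
  \<comment> \<open>The change of \<open>v\<close> under \<open>inv u\<close> is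
    \<open>- \<Psi> (inv u) w\<close>, and by unipotence \<open>\<Psi> (inv u)\<close> fixes
    \<open>w\<close> modulo \<open>N\<close> up to length \<open>k\<close>.\<close>
  have ww: "vanishes N (Suc k) (\<lambda>l. ?w l + w l)"
  proof -
    have d: "vanishes N (Suc k) (\<lambda>l. \<Psi> (inv u) w l - w l)" using ui van by (simp add: unipotent_def)
    have eq: "\<Psi> (inv u) v l - v l + w l = w l - \<Psi> (inv u) w l" for l
      unfolding w_eq by (rule uminus_add_conv_diff)
    show ?thesis unfolding eq by (rule vanishes_commute[OF d])
  qed
  show ?thesis
  proof (cases j rule: int_cases2)
    case (nonneg i)
    then show ?thesis using pos[of i] by (simp only: int_pow_int)
  next
    case (nonpos i)
    have eq: "(\<lambda>l. 1 * (\<Psi> (inv u [^] i) v l - v l - int i * ?w l) + int i * (?w l + w l)) =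
        (\<lambda>l. \<Psi> (u [^] j) v l - v l - j * w l)"
      using uc by (simp add: nonpos int_pow_neg_int nat_pow_inv algebra_simps)
    show ?thesis using vanishes_linear[OF neg ww, of 1 i "int i"] unfolding eq .
  qed
qed

section \<open>Congruence kernels of the representation\<close>

definition level_kernel :: "nat \<Rightarrow> nat \<Rightarrow> 'a set" where
  "level_kernel N m = {g \<in> carrier G. \<forall>v. vanishes (int N) m (\<lambda>l. \<Psi> g v l - v l)}"

lemma subgroup_level_kernel: "subgroup (level_kernel N m) G"
proof (rule subgroupI)
  show "level_kernel N m \<subseteq> carrier G" by (auto simp: level_kernel_def)
  have "\<one> \<in> level_kernel N m" by (simp add: level_kernel_def \<Psi>_one vanishes_def)
  then show "level_kernel N m \<noteq> {}" by blast
  fix x assume x: "x \<in> level_kernel N m"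
  have xc: "x \<in> carrier G" using x by (simp add: level_kernel_def)
  have "vanishes (int N) m (\<lambda>l. \<Psi> (inv x) v l - v l)" for v
  proof -
    have "vanishes (int N) m (\<lambda>l. \<Psi> x (\<Psi> (inv x) v) l - \<Psi> (inv x) v l)"
      using x by (simp add: level_kernel_def)
    then show ?thesis unfolding \<Psi>_inv[OF xc] by (rule vanishes_commute)
  qed
  then show "inv x \<in> level_kernel N m" using xc by (simp add: level_kernel_def)
  fix y assume y: "y \<in> level_kernel N m"
  have "vanishes (int N) m (\<lambda>l. \<Psi> (x \<otimes> y) v l - v l)" for v
  proof -
    have "vanishes (int N) m (\<lambda>l. (\<Psi> y (\<Psi> x v) l - \<Psi> x v l) + (\<Psi> x v l - v l))"
      by (rule vanishes_add) (use x y in \<open>simp_all add: level_kernel_def\<close>)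
    then show ?thesis using x y by (simp add: \<Psi>_mult level_kernel_def)
  qed
  then show "x \<otimes> y \<in> level_kernel N m" using x y by (simp add: level_kernel_def)
qed

lemma normal_level_kernel: "level_kernel N m \<lhd> G"
  unfolding normal_inv_iff
proof (intro conjI ballI subgroup_level_kernel)
  fix y g assume y: "y \<in> carrier G" and g: "g \<in> level_kernel N m"
  have gc: "g \<in> carrier G" using g by (simp add: level_kernel_def)
  have "vanishes (int N) m (\<lambda>l. \<Psi> (y \<otimes> g \<otimes> inv y) v l - v l)" for v
  proof -
    have "vanishes (int N) m (\<lambda>l. \<Psi> g (\<Psi> y v) l - \<Psi> y v l)" using g by (simp add: level_kernel_def)
    then have "vanishes (int N) m (\<Psi> (inv y) (\<lambda>l. \<Psi> g (\<Psi> y v) l - \<Psi> y v l))"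
      using y vanishes_\<Psi> inv_closed by blast
    then show ?thesis using y gc by (simp add: \<Psi>_mult \<Psi>_diff \<Psi>_inv)
  qed
  then show "y \<otimes> g \<otimes> inv y \<in> level_kernel N m" using y gc by (simp add: level_kernel_def)
qed

text \<open>Each further factor \<open>N\<close> in the exponent gains one length: for the operator
  x of the \<open>N ^ j\<close>-th power, x^N - 1 agrees with N (x - 1) wherever (x - 1)^2 vanishes,
  and a multiple of \<open>N\<close> vanishes modulo \<open>N\<close>.\<close>

lemma unipotent_pow_pow:
  assumes "unipotent u" "vanishes (int N) k v"
  shows "vanishes (int N) (Suc k + j) (\<lambda>l. \<Psi> (u [^] (N ^ j)) v l - v l)"
  using assms(2)
proof (induction j arbitrary: k v)
  case 0
  then show ?case using assms(1) by (simp add: unipotent_def)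
next
  case (Suc j)
  have u: "u \<in> carrier G" using assms(1) by (simp add: unipotent_def)
  let ?x = "u [^] (N ^ j)"
  let ?w = "\<lambda>l. \<Psi> ?x v l - v l"
  have w: "vanishes (int N) (Suc k + j) ?w" by (rule Suc.IH[OF Suc.prems])
  \<comment> \<open>The induction hypothesis is used a second time, for \<open>?w\<close> in place
    of \<open>v\<close> with its larger vanishing length; hence the generalisation over
    \<open>k\<close> and \<open>v\<close>.\<close>
  have "vanishes (int N) (Suc (Suc k) + j) (\<lambda>l. \<Psi> ?x ?w l - ?w l)"
    by (rule vanishes_mono[OF Suc.IH[OF w]]) simp
  then have "vanishes (int N) (Suc (Suc k) + j) (\<lambda>l. \<Psi> (?x [^] N) v l - v l - int N * ?w l)"
    by (intro \<Psi>_pow_expansion[OF _ _ HOL.refl]) (use u in auto)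
  moreover have "vanishes (int N) (Suc (Suc k) + j) (\<lambda>l. int N * ?w l)" by (simp add: vanishes_def)
  ultimately have "vanishes (int N) (Suc (Suc k) + j)
      (\<lambda>l. (\<Psi> (?x [^] N) v l - v l - int N * ?w l) + int N * ?w l)"
    by (rule vanishes_add)
  then have "vanishes (int N) (Suc (Suc k) + j) (\<lambda>l. \<Psi> (?x [^] N) v l - v l)"
    by (simp only: diff_add_cancel)
  then show ?case using u by (simp add: nat_pow_pow mult.commute)
qed

lemma finite_rcosets_level_kernel:
  assumes "finite (carrier P)" "N > 0"
  shows "finite (rcosets (level_kernel N m))"
proof -
  define L where "L = {l \<in> words. length l < m}"
  have "finite {l. set l \<subseteq> carrier P \<and> length l \<le> m}" using assms(1) by (rule finite_lists_length_le)
  then have L: "finite L" by (rule finite_subset[rotated]) (auto simp: L_def words_def)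
  \<comment> \<open>\<open>red v\<close> is a representative of \<open>v\<close> modulo functions
    divisible by \<open>N\<close> on \<open>L\<close>. Outside \<open>L\<close> its value is
    \<open>undefined\<close>, which does not affect \<open>vanishes\<close> up to length
    \<open>m\<close>.\<close>
  define red where "red v = restrict (\<lambda>l. v l mod int N) L" for v :: "'c list \<Rightarrow> int"
  define X where "X = L \<rightarrow>\<^sub>E {0..<int N}"
  have red: "red v \<in> X" for v using assms(2) by (auto simp: red_def X_def)
  have van: "vanishes (int N) m (\<lambda>l. v l - w l) \<longleftrightarrow> red v = red w" for v w
  proof -
    have "red v = red w \<longleftrightarrow> (\<forall>l\<in>L. v l mod int N = w l mod int N)"
      by (auto simp: red_def restrict_def fun_eq_iff)
    then show ?thesis by (auto simp: vanishes_def L_def mod_eq_dvd_iff)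
  qed
  have X: "finite X" unfolding X_def using L by (intro finite_PiE) auto
  \<comment> \<open>\<open>F g\<close> records the action on the finite set of representatives,
    which determines \<open>g\<close> modulo the kernel.\<close>
  define F where "F g = restrict (\<lambda>v. red (\<Psi> g v)) X" for g
  show ?thesis
  proof (rule finite_rcosetsI[OF subgroup_level_kernel])
    have "F ` carrier G \<subseteq> X \<rightarrow>\<^sub>E X" using red by (auto simp: F_def)
    moreover have "finite (X \<rightarrow>\<^sub>E X)" using X by (intro finite_PiE) auto
    ultimately show "finite (F ` carrier G)" by (rule finite_subset)
  next
    fix x y assume x: "x \<in> carrier G" and y: "y \<in> carrier G" and eq: "F x = F y"
    have "vanishes (int N) m (\<lambda>l. \<Psi> (x \<otimes> inv y) v l - v l)" for v
    proof -
      have "red (red v) = red v" by (auto simp: red_def)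
      then have v: "vanishes (int N) m (\<lambda>l. v l - red v l)" unfolding van by simp
      have "red (\<Psi> x v) = red (\<Psi> x (red v))"
        using vanishes_\<Psi>[OF x v] x by (simp add: \<Psi>_diff flip: van)
      also have "\<dots> = red (\<Psi> y (red v))"
        using fun_cong[OF eq, of "red v"] red[of v] by (simp add: F_def)
      also have "\<dots> = red (\<Psi> y v)"
        by (rule HOL.sym) (use vanishes_\<Psi>[OF y v] y in \<open>simp add: \<Psi>_diff flip: van\<close>)
      finally have "vanishes (int N) m (\<lambda>l. \<Psi> x v l - \<Psi> y v l)" unfolding van .
      then have "vanishes (int N) m (\<Psi> (inv y) (\<lambda>l. \<Psi> x v l - \<Psi> y v l))"
        using y vanishes_\<Psi> inv_closed by blast
      then show ?thesis using x y by (simp add: \<Psi>_mult \<Psi>_diff \<Psi>_inv)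
    qed
    then show "x \<otimes> inv y \<in> level_kernel N m" using x y by (simp add: level_kernel_def)
  qed
qed

text \<open>The \<open>e\<close>-th power of any element is unipotent, and its
  \<open>N ^ m\<close>-th power then acts trivially modulo \<open>N\<close> on words shorter than
  \<open>m\<close>.\<close>

lemma open_normal_level_kernel:
  assumes "exponents \<P>" "finite (carrier P)" "e \<in> \<P>" "N \<in> \<P>"
    and exp: "\<And>y. y \<in> carrier P \<Longrightarrow> y [^]\<^bsub>P\<^esub> e = \<one>\<^bsub>P\<^esub>"
  shows "open_normal \<P> G (level_kernel N m)"
  unfolding open_normal_def
proof (intro conjI normal_level_kernel bexI ballI)
  interpret exponents \<P> by fact
  show "finite (rcosets (level_kernel N m))"
    using assms pos by (intro finite_rcosets_level_kernel) auto
  show "e * N ^ m \<in> \<P>" using assms mult_mem power_mem by blast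
  fix x assume x: "x \<in> carrier G"
  have "vanishes (int N) m (\<lambda>l. \<Psi> ((x [^] e) [^] (N ^ m)) v l - v l)" for v
    by (rule vanishes_mono[OF unipotent_pow_pow[OF unipotent_pow[OF x exp], of N 0]]) (auto simp: vanishes_def)
  then show "x [^] (e * N ^ m) \<in> level_kernel N m"
    using x by (simp add: level_kernel_def nat_pow_pow)
qed

end

section \<open>Alternating words\<close>

context amalgamated_retracts
begin

abbreviation factor :: "bool \<Rightarrow> 'a set" where
  "factor t \<equiv> if t then A else B"

fun alternating :: "bool \<Rightarrow> 'a list \<Rightarrow> bool" where
  "alternating t [] \<longleftrightarrow> True"
| "alternating t (x # xs) \<longleftrightarrow> x \<in> factor t - H \<and> alternating (\<not> t) xs"

definition wprod :: "'a list \<Rightarrow> 'a" where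
  "wprod xs = foldr (\<otimes>) xs \<one>"

lemma wprod_simps [simp]: "wprod [] = \<one>" "wprod (x # xs) = x \<otimes> wprod xs"
  by (simp_all add: wprod_def)

lemma alternating_append:
  "alternating t (xs @ ys) \<longleftrightarrow> alternating t xs \<and> alternating (even (length xs) = t) ys"
  by (induction xs arbitrary: t) auto

lemma alternating_carrier: "alternating t xs \<Longrightarrow> set xs \<subseteq> carrier G"
  by (induction xs arbitrary: t) (auto simp: AB_carrier split: if_splits)

lemma alternating_set: "alternating t xs \<Longrightarrow> x \<in> set xs \<Longrightarrow> x \<in> A \<union> B \<and> x \<notin> H"
  by (induction xs arbitrary: t) (auto split: if_splits)

lemma wprod_closed: "set xs \<subseteq> carrier G \<Longrightarrow> wprod xs \<in> carrier G"
  by (induction xs) auto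

lemma wprod_append:
  "set xs \<subseteq> carrier G \<Longrightarrow> set ys \<subseteq> carrier G \<Longrightarrow> wprod (xs @ ys) = wprod xs \<otimes> wprod ys"
  by (induction xs) (auto simp: wprod_closed m_assoc)

text \<open>Even length puts the first and last letters into different factors, so copies of the
  word can be concatenated.\<close>

lemma alternating_concat_replicate:
  assumes "alternating t xs" "even (length xs)"
  shows "alternating t (concat (replicate n xs)) \<and> wprod (concat (replicate n xs)) = wprod xs [^] n"
proof (induction n)
  case (Suc n)
  have "set (concat (replicate n xs)) \<subseteq> carrier G" using alternating_carrier Suc by blast
  then show ?case
    using Suc assms alternating_carrier[OF assms(1)] nat_pow_Suc2[OF wprod_closed]
    by (simp add: alternating_append wprod_append)
qed simp

lemma subgroup_factor: "subgroup (factor t) G"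
  using sub by simp

lemma H_factor: "h \<in> H \<Longrightarrow> h \<in> factor t"
  using HA HB by auto

lemma mult_H_left:
  assumes "x \<in> factor t - H" "h \<in> H"
  shows "h \<otimes> x \<in> factor t - H"
proof
  have x: "x \<in> carrier G" and h: "h \<in> carrier G"
    using assms AB_carrier by (auto split: if_splits)
  show "h \<otimes> x \<in> factor t"
    using subgroup.m_closed[OF subgroup_factor H_factor[OF assms(2)]] assms(1) by blast
  show "h \<otimes> x \<notin> H"
  proof
    assume "h \<otimes> x \<in> H"
    then have "inv h \<otimes> (h \<otimes> x) \<in> H"
      using assms(2) subgroup.m_closed[OF sub(3)] subgroup.m_inv_closed[OF sub(3)] by blast
    then show False using assms(1) x h by simp
  qed
qed

lemma mult_H_right:
  assumes "x \<in> factor t - H" "h \<in> H"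
  shows "x \<otimes> h \<in> factor t - H"
proof
  have x: "x \<in> carrier G" and h: "h \<in> carrier G"
    using assms AB_carrier by (auto split: if_splits)
  show "x \<otimes> h \<in> factor t"
    using subgroup.m_closed[OF subgroup_factor _ H_factor[OF assms(2)]] assms(1) by blast
  show "x \<otimes> h \<notin> H"
  proof
    assume "x \<otimes> h \<in> H"
    then have "(x \<otimes> h) \<otimes> inv h \<in> H"
      using assms(2) subgroup.m_closed[OF sub(3)] subgroup.m_inv_closed[OF sub(3)] by blast
    then show False using assms(1) x h by (simp add: m_assoc)
  qed
qed

definition reduced :: "'a \<Rightarrow> bool" where
  "reduced g \<longleftrightarrow> g \<in> H \<or> (\<exists>t ws. ws \<noteq> [] \<and> alternating t ws \<and> g = wprod ws)"

lemma reducedI: "ws \<noteq> [] \<Longrightarrow> alternating t ws \<Longrightarrow> reduced (wprod ws)"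
  unfolding reduced_def by blast

text \<open>The new letter is absorbed if it lies in \<open>H\<close>, put in front if it comes from
  the other factor, and otherwise merged with the first letter. If the merged letter falls into
  \<open>H\<close>, it is absorbed into the second letter.\<close>

lemma reduced_factor_mult:
  assumes x: "x \<in> factor t" and "reduced g"
  shows "reduced (x \<otimes> g)"
proof -
  have in_factor: "reduced y" if "y \<in> factor u" for y u
  proof (cases "y \<in> H")
    case False
    moreover have "y \<in> carrier G" using that AB_carrier by (auto split: if_splits)
    ultimately show ?thesis using reducedI[of "[y]" u] that by auto
  qed (simp add: reduced_def)
  have xc: "x \<in> carrier G" using x AB_carrier by (auto split: if_splits)
  show ?thesis
  proof (cases "g \<in> H")
    case True
    then show ?thesis
      using in_factor[OF subgroup.m_closed[OF subgroup_factor x H_factor]] by blast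
  next
    case False
    then obtain u w ws where alt: "alternating u (w # ws)" and g: "g = wprod (w # ws)"
      using assms(2) unfolding reduced_def by (metis list.exhaust)
    have w: "w \<in> factor u - H" and ws: "alternating (\<not> u) ws" using alt by auto
    have wc: "w \<in> carrier G" and wsc: "wprod ws \<in> carrier G"
      using alternating_carrier[OF alt] wprod_closed by auto
    have xg: "x \<otimes> g = wprod ((x \<otimes> w) # ws)" using g xc wc wsc by (simp add: m_assoc)
    consider "x \<in> H" | "x \<notin> H" "u \<noteq> t" | "u = t" "x \<otimes> w \<notin> H" | "u = t" "x \<otimes> w \<in> H"
      by blast
    then show ?thesis
    proof cases
      case 1
      show ?thesis unfolding xg
        by (rule reducedI[of _ u]) (use mult_H_left[OF w 1] ws in auto)
    next
      case 2
      then have "u = (\<not> t)" by blast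
      then have "alternating t (x # w # ws)" using 2 x alt by simp
      then show ?thesis using reducedI[of "x # w # ws" t] g by simp
    next
      case 3
      then have "x \<otimes> w \<in> factor u - H" using subgroup.m_closed[OF subgroup_factor x, of w] w by blast
      then show ?thesis unfolding xg by (intro reducedI[of _ u]) (use ws in auto)
    next
      case 4
      show ?thesis
      proof (cases ws)
        case Nil
        then show ?thesis using xg 4 xc wc by (simp add: reduced_def)
      next
        case (Cons w' ws')
        then have w': "w' \<in> factor (\<not> u) - H" "alternating u ws'" using ws by auto
        have "w' \<in> carrier G" "wprod ws' \<in> carrier G"
          using alternating_carrier[OF alt] wprod_closed Cons by auto
        then have "x \<otimes> g = wprod (((x \<otimes> w) \<otimes> w') # ws')"
          using xg xc wc Cons by (simp add: m_assoc)
        moreover have "alternating (\<not> u) (((x \<otimes> w) \<otimes> w') # ws')"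
          using mult_H_left[OF w'(1) 4(2)] w'(2) by simp
        ultimately show ?thesis using reducedI by (metis list.distinct(1))
      qed
    qed
  qed
qed

lemma reduced: 
  assumes "g \<in> carrier G"
  shows "reduced g"
proof -
  \<comment> \<open>Stated for left multiplication of any reduced element, which makes the case of a
    product immediate.\<close>
  have "\<forall>y. y \<in> carrier G \<longrightarrow> reduced y \<longrightarrow> reduced (g \<otimes> y)"
    using assms
  proof (induction g rule: gen_induct)
    case (A a)
    then show ?case using reduced_factor_mult[of a True] by simp
  next
    case (B b)
    then show ?case using reduced_factor_mult[of b False] by simp
  qed (auto simp: m_assoc)
  moreover have "reduced \<one>" using subgroup.one_closed[OF sub(3)] by (simp add: reduced_def)
  ultimately show ?thesis using assms by (metis one_closed r_one)
qed

text \<open>In a word of odd length above 1 the first and last letters lie in the same factor.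
  Conjugation by the first letter moves it to the end, where both merge. If the result is outside
  \<open>H\<close>, the length has become even; otherwise it is absorbed into the preceding letter
  and the word has become shorter.\<close>

lemma cyclically_reduced:
  assumes "alternating t ws" "ws \<noteq> []"
  shows "\<exists>x \<in> carrier G. inv x \<otimes> wprod ws \<otimes> x \<in> A \<union> B \<or>
    (\<exists>u vs. vs \<noteq> [] \<and> even (length vs) \<and> alternating u vs \<and> inv x \<otimes> wprod ws \<otimes> x = wprod vs)"
  using assms
proof (induction "length ws" arbitrary: t ws rule: less_induct)
  case less
  have c: "set ws \<subseteq> carrier G" using alternating_carrier[OF less.prems(1)] .
  then have pc: "wprod ws \<in> carrier G" by (rule wprod_closed)
  consider "even (length ws)" | w where "ws = [w]" | w mid w' where "ws = w # mid @ [w']" "odd (length mid)"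
  proof (cases "even (length ws)")
    case False
    then obtain w vs where vs: "ws = w # vs" "even (length vs)" by (cases ws) auto
    show ?thesis
    proof (cases vs rule: rev_cases)
      case Nil
      then show ?thesis using that(2) vs by blast
    next
      case (snoc mid w')
      then show ?thesis using that(3) vs by simp
    qed
  qed (use that in blast)
  then show ?case
  proof cases
    case 1
    then show ?thesis using less.prems pc by (intro bexI[of _ \<one>]) auto
  next
    case 2
    then have "wprod ws \<in> A \<union> B" using less.prems c by (auto split: if_splits)
    then show ?thesis using pc by (intro bexI[of _ \<one>]) auto
  next
    case 3
    have w: "w \<in> factor t - H" "alternating (\<not> t) mid" "w' \<in> factor t - H"
      using less.prems(1) 3 by (auto simp: alternating_append)
    have wc: "w \<in> carrier G" "w' \<in> carrier G" "set mid \<subseteq> carrier G" using c 3 by auto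
    then have mc: "wprod mid \<in> carrier G" using wprod_closed by blast
    define z where "z = w' \<otimes> w"
    have zc: "z \<in> carrier G" using wc by (simp add: z_def)
    have z: "z \<in> factor t" using w subgroup.m_closed[OF subgroup_factor, of w' t w] by (simp add: z_def)
    have conj: "inv w \<otimes> wprod ws \<otimes> w = wprod (mid @ [z])"
      using wc mc 3 by (simp add: wprod_append z_def m_assoc)
    show ?thesis
    proof (cases "z \<in> H")
      case False
      then have "alternating (\<not> t) (mid @ [z])" using w(2) z 3 by (simp add: alternating_append)
      then show ?thesis using conj 3 wc
        by (intro bexI[of _ w] disjI2 exI[of _ "\<not> t"] exI[of _ "mid @ [z]"]) auto
    next
      case True
      obtain mid' u where mid: "mid = mid' @ [u]" using 3 by (metis odd_pos length_greater_0_conv rev_exhaust)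
      have u: "u \<in> factor (\<not> t) - H" "alternating (\<not> t) mid'" "even (length mid')"
        using w(2) mid 3 by (auto simp: alternating_append)
      have uc: "u \<in> carrier G" "set mid' \<subseteq> carrier G" using wc mid by auto
      let ?vs = "mid' @ [u \<otimes> z]"
      have "alternating (\<not> t) ?vs" using u mult_H_right[OF u(1) True] by (simp add: alternating_append)
      moreover have "length ?vs < length ws" "?vs \<noteq> []" using 3 mid by auto
      ultimately obtain y where y: "y \<in> carrier G" "inv y \<otimes> wprod ?vs \<otimes> y \<in> A \<union> B \<or>
        (\<exists>u vs. vs \<noteq> [] \<and> even (length vs) \<and> alternating u vs \<and> inv y \<otimes> wprod ?vs \<otimes> y = wprod vs)"
        using less.hyps by blast
      have "wprod (mid @ [z]) = wprod ?vs"
        using uc zc mid by (simp add: wprod_append m_assoc wprod_closed)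
      moreover have "inv (w \<otimes> y) \<otimes> wprod ws \<otimes> (w \<otimes> y) = inv y \<otimes> (inv w \<otimes> wprod ws \<otimes> w) \<otimes> y"
        using wc y(1) pc by (simp add: inv_mult_group m_assoc)
      ultimately have "inv (w \<otimes> y) \<otimes> wprod ws \<otimes> (w \<otimes> y) = inv y \<otimes> wprod ?vs \<otimes> y"
        by (simp only: conj)
      then show ?thesis using y wc by (intro bexI[of _ "w \<otimes> y"]) auto
    qed
  qed
qed

text \<open>The factors act by \<open>shift_op\<close> with opposite parities. On \<open>H\<close>
  the map \<open>\<rho>\<close> is the identity and the indicator function is invariant, so both
  operators are the same letterwise substitution and extend to \<open>G\<close> by
  \<open>lift\<close>.\<close>

lemma ex_amalgam_rep:
  assumes "U \<lhd> G"
  shows "\<exists>\<Psi>. amalgam_rep G A B H \<pi>A \<pi>B \<rho> (G Mod U) (\<lambda>x. U #> x) s \<Psi>"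
proof -
  interpret U: normal U G by fact
  let ?P = "G Mod U" and ?q = "\<lambda>x. U #> x"
  interpret P: group ?P by (rule U.factorgroup_is_group)
  have q: "?q \<in> hom G ?P" by (rule U.r_coset_hom_Mod)
  interpret q: group_hom G ?P ?q using q by unfold_locales
  define \<chi> where "\<chi> = (\<lambda>x. if x \<in> ?q ` H then 1 else (0::int))"
  define f where "f E a = shift_op E \<chi> (lmult ?P (?q a)) (lmult ?P (?q (\<rho> a)))" for E a
  have qH: "subgroup (?q ` H) ?P" by (rule q.subgroup_img_is_subgroup[OF sub(3)])
  have \<chi>: "\<chi> (lmult ?P (?q h) x) = \<chi> x" if "h \<in> H" for h x
  proof (cases "x \<in> carrier ?P")
    case True
    have h: "?q h \<in> ?q ` H" "?q h \<in> carrier ?P" using that AB_carrier q.hom_closed by auto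
    have "?q h \<otimes>\<^bsub>?P\<^esub> x \<in> ?q ` H \<longleftrightarrow> x \<in> ?q ` H"
    proof
      assume "?q h \<otimes>\<^bsub>?P\<^esub> x \<in> ?q ` H"
      then have "inv\<^bsub>?P\<^esub> (?q h) \<otimes>\<^bsub>?P\<^esub> (?q h \<otimes>\<^bsub>?P\<^esub> x) \<in> ?q ` H"
        by (rule subgroup.m_closed[OF qH subgroup.m_inv_closed[OF qH h(1)]])
      then show "x \<in> ?q ` H" by (simp only: P.inv_cancel_left(1)[OF h(2) True])
    qed (rule subgroup.m_closed[OF qH h(1)])
    then show ?thesis using True by (simp add: \<chi>_def lmult_def)
  qed (simp add: lmult_def)
  have hom: "f E \<in> hom (G\<lparr>carrier := C\<rparr>) op_bij_group"
    if "subgroup C G" "\<And>n. E (Suc n) \<longleftrightarrow> \<not> E n" for E C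
  proof -
    have C: "C \<subseteq> carrier G" using that(1) by (rule subgroup.subset)
    have "?q \<in> hom (G\<lparr>carrier := C\<rparr>) ?P" "(\<lambda>a. ?q (\<rho> a)) \<in> hom (G\<lparr>carrier := C\<rparr>) ?P"
      using q Group.hom_compose[OF \<rho>(1) q] C by (simp_all add: hom_def Pi_iff subset_iff)
    then show ?thesis unfolding f_def
      by (intro shift_op_hom P.group_axioms subgroup_imp_group that) auto
  qed
  have "f E h = f E' h" if "h \<in> H" for E E' h
    using that shift_op_invariant[of \<chi> "lmult ?P (?q h)"] \<chi> by (intro ext) (simp add: f_def \<rho>)
  then obtain k where k: "k \<in> hom G op_bij_group" "\<forall>a\<in>A. k a = f (\<lambda>n. even n = s) a"
    "\<forall>b\<in>B. k b = f (\<lambda>n. even n \<noteq> s) b"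
    using lift[OF hom[OF sub(1)] hom[OF sub(2)], of "\<lambda>n. even n = s" "\<lambda>n. even n \<noteq> s"] by auto
  have "k \<one> = id" using hom_one[OF k(1) is_group group_op_bij_group] by (simp add: op_bij_group_def)
  moreover have "k (x \<otimes> y) = k y \<circ> k x" if "x \<in> carrier G" "y \<in> carrier G" for x y
    using hom_mult[OF k(1) that] by (simp add: op_bij_group_def)
  ultimately have "amalgam_rep G A B H \<pi>A \<pi>B \<rho> ?P ?q s k"
    using k(2,3) q by unfold_locales (simp_all add: f_def \<chi>_def)
  then show ?thesis by blast
qed

end

section \<open>Growth of alternating products\<close>

context amalgam_rep
begin

definition \<delta> :: "'c list \<Rightarrow> int" where
  "\<delta> l = (if l = [] then 1 else 0)"

text \<open>Composition is reversed, so the last letter \<open>w\<close> acts last. Its factor feeds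
  at tails of length \<open>length ws\<close>, so the support grows by one length, with coefficient
  -1: the indicator drops from 1 at the identity to 0 at \<open>q w\<close>.\<close>

lemma \<Psi>_alternating:
  assumes "alternating s ws" "\<And>w. w \<in> set ws \<Longrightarrow> q w \<notin> q ` H"
  shows "(\<forall>l. length l > length ws \<longrightarrow> \<Psi> (wprod ws) \<delta> l = 0) \<and>
    (\<exists>l \<in> words. length l = length ws \<and> \<bar>\<Psi> (wprod ws) \<delta> l\<bar> = 1)"
  using assms
proof (induction ws rule: rev_induct)
  case Nil
  then show ?case by (auto simp: \<Psi>_one \<delta>_def words_def)
next
  case (snoc w ws)
  have alt: "alternating s ws" and w: "w \<in> factor (even (length ws) = s) - H"
    using snoc.prems by (simp_all add: alternating_append)
  let ?v = "\<Psi> (wprod ws) \<delta>"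
  let ?E = "\<lambda>n. even n = (even (length ws))"
  let ?\<chi> = "\<lambda>x. if x \<in> q ` H then 1 else (0::int)"
  let ?\<sigma> = "lmult P (q w)" and ?\<tau> = "lmult P (q (\<rho> w))"
  have wc: "w \<in> carrier G" using w AB_carrier by (auto split: if_splits)
  have rc: "\<rho> w \<in> carrier G" using \<rho>(2)[OF wc] AB_carrier by blast
  have IH1: "?v l = 0" if "length l > length ws" for l using snoc alt that by simp
  obtain l where l: "l \<in> words" "length l = length ws" "\<bar>?v l\<bar> = 1" using snoc alt by auto
  have \<Psi>_w: "\<Psi> w = shift_op ?E ?\<chi> ?\<sigma> ?\<tau>"
  proof (cases "even (length ws) = s")
    case True
    then have "?E = (\<lambda>n. even n = s)" by auto
    then show ?thesis using \<Psi>_A[of w] w True by simp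
  next
    case False
    then have "?E = (\<lambda>n. even n \<noteq> s)" by auto
    then show ?thesis using \<Psi>_B[of w] w False by simp
  qed
  have "wprod (ws @ [w]) = wprod ws \<otimes> w"
    using alternating_carrier[OF alt] wc by (simp add: wprod_append)
  then have eq: "\<Psi> (wprod (ws @ [w])) \<delta> = shift_op ?E ?\<chi> ?\<sigma> ?\<tau> ?v"
    using wprod_closed[OF alternating_carrier[OF alt]] wc by (simp add: \<Psi>_mult \<Psi>_w)
  \<comment> \<open>The letterwise action of \<open>\<rho> w\<close> carries \<open>l'\<close> to
    \<open>l\<close>. The witness of the new length is \<open>l'\<close> with the identity of
    \<open>P\<close> in front, where the first summand of \<open>shift_op\<close> is 0 because its
    word is longer than \<open>ws\<close>.\<close>
  define l' where "l' = map (lmult P (inv\<^bsub>P\<^esub> (q (\<rho> w)))) l"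
  have l': "l' \<in> words" unfolding l'_def using l rc by (intro lmult_words) auto
  have "lmult P (q (\<rho> w)) \<circ> lmult P (inv\<^bsub>P\<^esub> (q (\<rho> w))) = id"
    using rc by (simp flip: P.lmult_mult add: P.lmult_one)
  then have l'_l: "map ?\<tau> l' = l" by (simp add: l'_def)
  have "q \<one> \<in> q ` H" using subgroup.one_closed[OF sub(3)] by blast
  then have "?\<chi> \<one>\<^bsub>P\<^esub> = 1" by simp
  moreover have "?\<chi> (?\<sigma> \<one>\<^bsub>P\<^esub>) = 0" using snoc.prems(2)[of w] wc by (simp add: lmult_def)
  moreover have len: "length l' = length ws" using l by (simp add: l'_def)
  ultimately have "shift_op ?E ?\<chi> ?\<sigma> ?\<tau> ?v (\<one>\<^bsub>P\<^esub> # l') = - ?v l"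
    by (simp add: l'_l IH1 l(2))
  then have "\<bar>shift_op ?E ?\<chi> ?\<sigma> ?\<tau> ?v (\<one>\<^bsub>P\<^esub> # l')\<bar> = 1" using l(3) by simp
  moreover have "\<one>\<^bsub>P\<^esub> # l' \<in> words" using l' by (simp add: words_def)
  moreover have "shift_op ?E ?\<chi> ?\<sigma> ?\<tau> ?v m = 0" if "length m > length (ws @ [w])" for m
    using that by (cases m) (auto simp: IH1)
  ultimately show ?case unfolding eq using len by (metis length_Cons length_append_singleton)
qed

end

lemma (in normal) rcos_nat_pow:
  assumes "x \<in> carrier G" "y \<in> carrier G" "x \<otimes> inv y \<in> H"
  shows "x [^] (n::nat) \<otimes> inv (y [^] n) \<in> H"
proof -
  have "H #> x = H #> y" using rcos_eq_iff[OF subgroup_axioms] assms by simp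
  then have "H #> x [^] n = H #> y [^] n"
    using FactGroup_pow[OF assms(1), of n] FactGroup_pow[OF assms(2), of n] by simp
  then show ?thesis using rcos_eq_iff[OF subgroup_axioms] assms by simp
qed

section \<open>Separation from the powers of an element\<close>

context amalgam_rep
begin

text \<open>Agreement of \<open>g\<close> with \<open>c [^] j\<close> modulo a congruence kernel
  passes to the \<open>e\<close>-th powers, and the lowest layer moved by \<open>c [^] e\<close>
  turns it into a linear congruence for \<open>j\<close>. Either some modulus excludes every
  \<open>j\<close>, or the congruence would force a power of \<open>g\<close> to agree with a fixed
  power of \<open>c\<close> modulo a subgroup chosen to separate them.\<close>

lemma separate_from_powers:
  assumes "exponents \<P>" and fin: "finite (carrier P)" and e: "e \<in> \<P>"
    and exp: "\<And>y. y \<in> carrier P \<Longrightarrow> y [^]\<^bsub>P\<^esub> e = \<one>\<^bsub>P\<^esub>"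
    and c: "c \<in> carrier G" and l: "l \<in> words" "l \<noteq> []" "\<Psi> (c [^] e) \<delta> l \<noteq> 0"
    and res: "\<And>g. g \<in> carrier G \<Longrightarrow> g \<noteq> \<one> \<Longrightarrow> \<exists>U. open_normal \<P> G U \<and> g \<notin> U"
    and iso: "exponents.isolated \<P> (generate G {c}) G"
    and g: "g \<in> carrier G" "g \<notin> generate G {c}"
  shows "\<exists>U. open_normal \<P> G U \<and> (\<forall>j::int. g \<otimes> inv (c [^] j) \<notin> U)"
proof -
  interpret exponents \<P> by fact
  define u where "u = c [^] e"
  have u: "unipotent u" unfolding u_def by (rule unipotent_pow[OF c exp])
  have uc: "u \<in> carrier G" using c by (simp add: u_def)
  define w where "w = (\<lambda>l. \<Psi> u \<delta> l - \<delta> l)"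
  have "w l \<noteq> 0" using l by (simp add: w_def u_def \<delta>_def)
  then have ex: "\<exists>k. \<exists>l\<in>words. length l = k \<and> w l \<noteq> 0" using l(1) by blast
  \<comment> \<open>\<open>k\<close> is the least length of a word at which \<open>u\<close> changes
    \<delta>, and \<open>m\<close> below is such a word.\<close>
  define k where "k = (LEAST k. \<exists>l\<in>words. length l = k \<and> w l \<noteq> 0)"
  have "\<exists>l\<in>words. length l = k \<and> w l \<noteq> 0" using LeastI_ex[OF ex] unfolding k_def .
  then obtain m where m: "m \<in> words" "length m = k" "w m \<noteq> 0" by blast
  have w0: "w l' = 0" if "l' \<in> words" "length l' < k" for l'
    using not_less_Least[of "length l'"] that unfolding k_def by blast
  then have "vanishes 0 k w" by (simp add: vanishes_def)
  then have van: "vanishes 0 (Suc k) (\<lambda>l. \<Psi> (u [^] j) \<delta> l - \<delta> l - j * w l)" for j :: int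
    by (rule unipotent_int_pow_expansion[OF u w_def])
  \<comment> \<open>Vanishing modulo 0 makes the expansion an equality of integers up to length
    \<open>k\<close>.\<close>
  have expand: "\<Psi> (u [^] j) \<delta> l' = \<delta> l' + j * w l'" if "l' \<in> words" "length l' \<le> k" for j :: int and l'
  proof -
    have "length l' < Suc k" using that(2) by simp
    then have "0 dvd \<Psi> (u [^] j) \<delta> l' - \<delta> l' - j * w l'"
      by (rule van[of j, unfolded vanishes_def, rule_format, OF that(1)])
    then show ?thesis by (simp only: dvd_0_left_iff diff_diff_eq right_minus_eq)
  qed
  have "w [] = 0" using \<Psi>_Nil[OF uc] by (simp add: w_def)
  then have m_ne: "m \<noteq> []" using m(3) by blast
  define z where "z = \<Psi> (g [^] e) \<delta>"
  define K where "K N = level_kernel N (Suc k)" for N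
  have K: "open_normal \<P> G (K N)" if "N \<in> \<P>" for N
    unfolding K_def by (rule open_normal_level_kernel[OF assms(1) fin e that exp])
  \<comment> \<open>Modulo \<open>K N\<close> the \<open>e\<close>-th powers of \<open>g\<close> and
    \<open>c [^] j\<close> agree, and the latter is \<open>u [^] j\<close>. Applying both to
    \<delta> gives the congruence.\<close>
  have key: "int N dvd z l' - (\<delta> l' + j * w l')"
    if "g \<otimes> inv (c [^] j) \<in> K N" "l' \<in> words" "length l' \<le> k" for N l' and j :: int
  proof -
    interpret K: normal "K N" G unfolding K_def by (rule normal_level_kernel)
    have cu: "(c [^] j) [^] e = u [^] j"
      unfolding u_def by (simp only: int_pow_int[symmetric] int_pow_pow[OF c] mult.commute)
    have cj: "c [^] j \<in> carrier G" using c by (rule int_pow_closed)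
    have "g [^] e \<otimes> inv ((c [^] j) [^] e) \<in> K N"
      by (rule K.rcos_nat_pow[OF g(1) cj that(1)])
    define t where "t = g [^] e \<otimes> inv (u [^] j)"
    have "t \<in> K N" unfolding t_def cu[symmetric] by fact
    then have t: "t \<in> carrier G" "vanishes (int N) (Suc k) (\<lambda>l. \<Psi> t \<delta> l - \<delta> l)"
      unfolding K_def level_kernel_def by blast+
    have uj: "u [^] j \<in> carrier G" using uc by (rule int_pow_closed)
    have "t \<otimes> u [^] j = g [^] e" unfolding t_def using g uj by (simp add: m_assoc)
    then have "\<Psi> (u [^] j) (\<Psi> t \<delta>) = z"
      using \<Psi>_mult[OF t(1) uj] by (simp add: z_def)
    then have "vanishes (int N) (Suc k) (\<lambda>l. z l - \<Psi> (u [^] j) \<delta> l)"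
      using vanishes_\<Psi>[OF uj t(2)] by (simp only: \<Psi>_diff[OF uj])
    then have "int N dvd z l' - \<Psi> (u [^] j) \<delta> l'"
      using that(2,3) unfolding vanishes_def by (simp only: less_Suc_eq_le)
    then show ?thesis unfolding expand[OF that(2,3)] .
  qed
  show ?thesis
  proof (cases "\<forall>l' \<in> words. length l' < k \<longrightarrow> z l' = \<delta> l'")
    case False
    then obtain l' where l': "l' \<in> words" "length l' < k" "z l' \<noteq> \<delta> l'" by blast
    \<comment> \<open>Below length \<open>k\<close> the function \<open>w\<close> is 0, so the
      congruence does not involve \<open>j\<close>, and one modulus larger than the difference
      excludes all \<open>j\<close>.\<close>
    obtain N where N: "N \<in> \<P>" "nat \<bar>z l' - \<delta> l'\<bar> < N" using unbounded by blast
    have "g \<otimes> inv (c [^] j) \<notin> K N" for j :: int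
    proof
      assume "g \<otimes> inv (c [^] j) \<in> K N"
      then have "int N dvd z l' - \<delta> l'" using key[of j N l'] l' w0 by simp
      then have "int N \<le> \<bar>z l' - \<delta> l'\<bar>" using l'(3) by (intro zdvd_imp_le) auto
      then show False using N(2) by linarith
    qed
    then show ?thesis using K[OF N(1)] by blast
  next
    case True
    have key_m: "int N dvd z m - j * w m" if "g \<otimes> inv (c [^] j) \<in> K N" for N and j :: int
      using key[OF that m(1)] m(2) m_ne by (simp add: \<delta>_def)
    have "nat \<bar>w m\<bar> > 0" using m(3) by simp
    \<comment> \<open>\<open>a\<close> serves as a modulus, while \<open>b\<close> is coprime to all
      exponents and so is a degree to which \<open>iso\<close> applies.\<close>
    then obtain a b where a: "a \<in> \<P>" and ab: "nat \<bar>w m\<bar> = a * b" and b: "\<forall>n\<in>\<P>. coprime b n"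
      using split by blast
    have wm: "w m = sgn (w m) * (int a * int b)"
      using ab by (metis abs_ge_zero int_nat_eq of_nat_mult sgn_mult_abs)
    show ?thesis
    proof (cases "int a dvd z m")
      case False
      \<comment> \<open>Modulo \<open>a\<close> the term with \<open>j\<close> disappears, so
        agreement would make \<open>a\<close> divide \<open>z m\<close>.\<close>
      have "int a dvd w m" using wm by (metis dvd_mult dvd_triv_left)
      then have "g \<otimes> inv (c [^] j) \<notin> K a" for j :: int
        using key_m[of j a] False by (metis dvd_diff_left_iff dvd_mult)
      then show ?thesis using K[OF a] by blast
    next
      case True
      then obtain d where d: "z m = int a * d" by auto
      \<comment> \<open>Cancelling \<open>a\<close> and the sign leaves the condition that
        \<open>j * b\<close> is congruent to \<open>r\<close>. Isolatedness keeps
        \<open>g [^] b\<close> out of the cyclic subgroup, so \<open>?t\<close> is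
        nontrivial.\<close>
      define r where "r = sgn (w m) * d"
      let ?t = "g [^] b \<otimes> inv (c [^] r)"
      have "?t \<noteq> \<one>"
      proof
        assume "?t = \<one>"
        then have "g [^] b = c [^] r"
          using g c by (metis inv_closed inv_equality inv_inv int_pow_closed nat_pow_closed)
        then have "g [^] b \<in> generate G {c}" using generate_pow[OF c] by blast
        then show False using iso g b unfolding isolated_def by blast
      qed
      then obtain U where U: "open_normal \<P> G U" "?t \<notin> U" using res[of ?t] g c by auto
      interpret U: normal U G using U(1) by (simp add: open_normal_def)
      obtain f where f: "f \<in> \<P>" "\<And>x. x \<in> carrier G \<Longrightarrow> x [^] f \<in> U"
        using U(1) by (auto simp: open_normal_def)
      \<comment> \<open>The modulus \<open>a * f\<close> leaves \<open>f\<close> after cancellation,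
        an exponent modulo \<open>U\<close>. Hence \<open>c [^] (j * b)\<close> agrees with
        \<open>c [^] r\<close> modulo \<open>U\<close>, and so does \<open>g [^] b\<close>, contrary
        to the choice of \<open>U\<close>.\<close>
      have "g \<otimes> inv (c [^] j) \<notin> U \<inter> K (a * f)" for j :: int
      proof
        assume *: "g \<otimes> inv (c [^] j) \<in> U \<inter> K (a * f)"
        then have "int (a * f) dvd z m - j * w m" by (intro key_m) blast
        also have "z m - j * w m = int a * (d - j * sgn (w m) * int b)"
          by (subst wm) (simp add: d algebra_simps)
        finally have "int f dvd d - j * sgn (w m) * int b"
          using pos[OF a] by simp
        then have "int f dvd sgn (w m) * (d - j * sgn (w m) * int b)" by (rule dvd_mult)
        also have "sgn (w m) * (d - j * sgn (w m) * int b) = r - (sgn (w m) * sgn (w m)) * j * int b"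
          by (simp add: r_def algebra_simps)
        also have "sgn (w m) * sgn (w m) = 1" using m(3) by (simp add: sgn_if)
        finally obtain i where i: "r - j * int b = int f * i" by auto
        have "(c [^] (- i)) [^] f \<in> U" using f c by simp
        also have "(c [^] (- i)) [^] f = c [^] (j * int b - r)"
          using c i by (simp add: int_pow_pow mult.commute minus_diff_eq[of r, symmetric] flip: int_pow_int)
        finally have "c [^] (j * int b) \<otimes> inv (c [^] r) \<in> U" using c by (simp add: int_pow_diff)
        then have 1: "U #> c [^] (j * int b) = U #> c [^] r"
          using rcos_eq_iff[OF U.subgroup_axioms] c by simp
        have "(c [^] j) [^] b = c [^] (j * int b)" using c by (simp add: int_pow_pow flip: int_pow_int)
        then have "g [^] b \<otimes> inv (c [^] (j * int b)) \<in> U"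
          using U.rcos_nat_pow[of g "c [^] j" b] * g c by simp
        then have "U #> g [^] b = U #> c [^] (j * int b)"
          using rcos_eq_iff[OF U.subgroup_axioms] g c by simp
        then show False using 1 U(2) rcos_eq_iff[OF U.subgroup_axioms] g c by simp
      qed
      moreover have "open_normal \<P> G (U \<inter> K (a * f))"
        using open_normal_Int[OF U(1) K mult_mem] mult_mem a f(1) by blast
      ultimately show ?thesis by blast
    qed
  qed
qed

end

text \<open>Both assumptions concern elements of the factors and will follow by pulling admissible
  subgroups back along the retractions of \<open>G\<close> onto them. Residual admissibility of all
  of \<open>G\<close> is a conclusion.\<close>

locale separating_amalgam = amalgamated_retracts + exponents \<P> for \<P> +
  assumes separate_H: "x \<in> A \<union> B \<Longrightarrow> x \<notin> H \<Longrightarrow>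
      \<exists>U. open_normal \<P> G U \<and> (\<forall>h \<in> H. x \<otimes> inv h \<notin> U)"
    and residual_H: "h \<in> H \<Longrightarrow> h \<noteq> \<one> \<Longrightarrow> \<exists>U. open_normal \<P> G U \<and> h \<notin> U"
begin

lemma open_normal_carrier: "open_normal \<P> G (carrier G)"
proof -
  have "finite (rcosets (carrier G))"
    by (rule finite_rcosetsI[OF subgroup_self, of "\<lambda>x. ()"]) auto
  moreover have "carrier G \<lhd> G" by (auto simp: normal_inv_iff subgroup_self)
  ultimately show ?thesis using one_mem by (auto simp: open_normal_def)
qed

lemma separate_word:
  assumes "\<And>w. w \<in> set ws \<Longrightarrow> w \<in> A \<union> B \<and> w \<notin> H"
  shows "\<exists>U. open_normal \<P> G U \<and> (\<forall>w \<in> set ws. \<forall>h \<in> H. w \<otimes> inv h \<notin> U)"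
  using assms
proof (induction ws)
  case Nil
  then show ?case using open_normal_carrier by auto
next
  case (Cons w ws)
  then obtain U where U: "open_normal \<P> G U" "\<forall>w \<in> set ws. \<forall>h \<in> H. w \<otimes> inv h \<notin> U" by auto
  obtain V where V: "open_normal \<P> G V" "\<forall>h \<in> H. w \<otimes> inv h \<notin> V"
    using separate_H[of w] Cons.prems[of w] by auto
  have "open_normal \<P> G (U \<inter> V)" by (rule open_normal_Int[OF U(1) V(1) mult_mem])
  then show ?case using U(2) V(2) by auto
qed

text \<open>A single \<open>U\<close> keeps all letters outside the image of \<open>H\<close>, as
  \<open>\<Psi>_alternating\<close> requires.\<close>

lemma ex_rep_of_word:
  assumes "alternating s ws"
  shows "\<exists>U \<Psi> e. e \<in> \<P> \<and> amalgam_rep G A B H \<pi>A \<pi>B \<rho> (G Mod U) (\<lambda>x. U #> x) s \<Psi> \<and>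
    finite (carrier (G Mod U)) \<and> (\<forall>y \<in> carrier (G Mod U). y [^]\<^bsub>G Mod U\<^esub> e = \<one>\<^bsub>G Mod U\<^esub>) \<and>
    (\<forall>w \<in> set ws. U #> w \<notin> (\<lambda>x. U #> x) ` H)"
proof -
  obtain U where U: "open_normal \<P> G U" "\<forall>w \<in> set ws. \<forall>h \<in> H. w \<otimes> inv h \<notin> U"
    using separate_word[of ws] alternating_set[OF assms] by blast
  interpret U: normal U G using U(1) by (simp add: open_normal_def)
  obtain e where e: "e \<in> \<P>" "\<And>x. x \<in> carrier G \<Longrightarrow> x [^] e \<in> U"
    using U(1) by (auto simp: open_normal_def)
  have "finite (carrier (G Mod U))" using U(1) by (simp add: open_normal_def FactGroup_def)
  moreover have "y [^]\<^bsub>G Mod U\<^esub> e = \<one>\<^bsub>G Mod U\<^esub>" if "y \<in> carrier (G Mod U)" for y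
  proof -
    have "y \<in> (\<lambda>x. U #> x) ` carrier G" using that by (simp only: carrier_FactGroup)
    then obtain x where x: "y = U #> x" "x \<in> carrier G" by (rule imageE)
    have "y [^]\<^bsub>G Mod U\<^esub> e = U #> (x [^] e)" unfolding x(1) by (rule U.FactGroup_pow[OF x(2)])
    also have "\<dots> = U" by (rule U.rcos_const[OF is_group e(2)[OF x(2)]])
    finally show ?thesis by simp
  qed
  moreover have "U #> w \<notin> (\<lambda>x. U #> x) ` H" if "w \<in> set ws" for w
    using U.rcos_image_iff[OF subgroup.subset[OF sub(3)], of w] U(2) that alternating_carrier[OF assms] by blast
  ultimately show ?thesis using ex_amalgam_rep[OF U.normal_axioms, of s] e(1) by blast
qed

text \<open>An element outside \<open>H\<close> is an alternating product, so it moves \<delta> to a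
  function with value 1 or -1 at a nonempty word. There \<delta> is 0, and any modulus above 1 sees
  the difference.\<close>

lemma residual:
  assumes g: "g \<in> carrier G" "g \<noteq> \<one>"
  shows "\<exists>U. open_normal \<P> G U \<and> g \<notin> U"
proof (cases "g \<in> H")
  case False
  then obtain s ws where ws: "ws \<noteq> []" "alternating s ws" "g = wprod ws"
    using reduced[OF g(1)] by (auto simp: reduced_def)
  obtain U \<Psi> e where e: "e \<in> \<P>" and rep: "amalgam_rep G A B H \<pi>A \<pi>B \<rho> (G Mod U) (\<lambda>x. U #> x) s \<Psi>"
    and fin: "finite (carrier (G Mod U))"
    and exp: "\<And>y. y \<in> carrier (G Mod U) \<Longrightarrow> y [^]\<^bsub>G Mod U\<^esub> e = \<one>\<^bsub>G Mod U\<^esub>"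
    and w: "\<And>w. w \<in> set ws \<Longrightarrow> U #> w \<notin> (\<lambda>x. U #> x) ` H"
    using ex_rep_of_word[OF ws(2)] by blast
  interpret R: amalgam_rep G A B H \<pi>A \<pi>B \<rho> "G Mod U" "\<lambda>x. U #> x" s \<Psi> by (rule rep)
  obtain N where N: "N \<in> \<P>" "1 < N" using unbounded by blast
  let ?K = "R.level_kernel N (Suc (length ws))"
  have "g \<notin> ?K"
  proof
    assume "g \<in> ?K"
    then have van: "R.vanishes (int N) (Suc (length ws)) (\<lambda>l. \<Psi> g R.\<delta> l - R.\<delta> l)"
      by (simp add: R.level_kernel_def)
    obtain l where l: "l \<in> R.words" "length l = length ws" "\<bar>\<Psi> g R.\<delta> l\<bar> = 1"
      using R.\<Psi>_alternating[OF ws(2) w] ws(3) by blast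
    then have "R.\<delta> l = 0" using ws(1) by (auto simp: R.\<delta>_def)
    then have "int N dvd \<Psi> g R.\<delta> l" using van l by (auto simp: R.vanishes_def)
    then have "int N dvd 1" using l(3) by (metis dvd_abs_iff)
    then show False using N(2) by simp
  qed
  then show ?thesis using R.open_normal_level_kernel[OF exponents_axioms fin e N(1) exp] by blast
qed (use residual_H g in blast)

lemma residually_separable: "separable \<P> {\<one>} G"
  using residual triv_subgroup by (auto simp: separable_def)

text \<open>Up to conjugation the element is an alternating word of even length. Its powers stay
  alternating, so the \<open>e\<close>-th power moves \<delta>, as
  \<open>separate_from_powers\<close> requires.\<close>

lemma separable_hyperbolic:
  assumes c: "c \<in> carrier G" and hyp: "\<And>x. x \<in> carrier G \<Longrightarrow> inv x \<otimes> c \<otimes> x \<notin> A \<union> B"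
    and iso: "isolated (generate G {c}) G"
  shows "separable \<P> (generate G {c}) G"
proof -
  have main: "separable \<P> (generate G {wprod vs}) G"
    if vs: "vs \<noteq> []" "even (length vs)" "alternating s vs" and iso: "isolated (generate G {wprod vs}) G" for s vs
  proof -
    let ?d = "wprod vs"
    have d: "?d \<in> carrier G" using wprod_closed alternating_carrier[OF vs(3)] by blast
    obtain U \<Psi> e where e: "e \<in> \<P>" and rep: "amalgam_rep G A B H \<pi>A \<pi>B \<rho> (G Mod U) (\<lambda>x. U #> x) s \<Psi>"
      and fin: "finite (carrier (G Mod U))"
      and exp: "\<And>y. y \<in> carrier (G Mod U) \<Longrightarrow> y [^]\<^bsub>G Mod U\<^esub> e = \<one>\<^bsub>G Mod U\<^esub>"
      and w: "\<And>w. w \<in> set vs \<Longrightarrow> U #> w \<notin> (\<lambda>x. U #> x) ` H"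
      using ex_rep_of_word[OF vs(3)] by blast
    interpret R: amalgam_rep G A B H \<pi>A \<pi>B \<rho> "G Mod U" "\<lambda>x. U #> x" s \<Psi> by (rule rep)
    let ?ws = "concat (replicate e vs)"
    have ws: "alternating s ?ws" "wprod ?ws = ?d [^] e"
      using alternating_concat_replicate[OF vs(3,2), of e] by auto
    have "?ws \<noteq> []" using pos[OF e] vs(1) by simp
    moreover obtain l where l: "l \<in> R.words" "length l = length ?ws" "\<bar>\<Psi> (wprod ?ws) R.\<delta> l\<bar> = 1"
      using R.\<Psi>_alternating[OF ws(1)] w by force
    ultimately have l': "l \<noteq> []" "\<Psi> (?d [^] e) R.\<delta> l \<noteq> 0" using ws(2) by auto
    have "\<exists>V. open_normal \<P> G V \<and> (\<forall>y \<in> generate G {?d}. g \<otimes> inv y \<notin> V)"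
      if "g \<in> carrier G - generate G {?d}" for g
      using R.separate_from_powers[OF exponents_axioms fin e exp d l(1) l' residual iso, of g] that
      by (auto simp: generate_pow[OF d])
    then show ?thesis unfolding separable_def using generate_is_subgroup[of "{?d}"] d by auto
  qed
  have "c \<notin> H" using hyp[OF one_closed] c HA by auto
  then obtain t ws where ws: "ws \<noteq> []" "alternating t ws" "c = wprod ws"
    using reduced[OF c] by (auto simp: reduced_def)
  obtain x u vs where x: "x \<in> carrier G" and vs: "vs \<noteq> []" "even (length vs)" "alternating u vs"
    "inv x \<otimes> c \<otimes> x = wprod vs"
    using cyclically_reduced[OF ws(2,1)] hyp ws(3) by blast
  have conj: "conjugate_in G (generate G {c}) (generate G {wprod vs})"
  proof -
    interpret h: group_hom G G "\<lambda>y. inv x \<otimes> y \<otimes> x" by unfold_locales (rule conj_hom[OF x])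
    have "(\<lambda>y. inv x \<otimes> y \<otimes> x) ` generate G {c} = generate G {wprod vs}"
      using h.generate_img[of "{c}"] c vs(4) by simp
    then show ?thesis using x unfolding conjugate_in_def by blast
  qed
  have "separable \<P> (generate G {wprod vs}) G"
    using main[OF vs(1-3)] isolated_conj[OF is_group conj iso] by blast
  moreover have "generate G {wprod vs} \<subseteq> carrier G"
    using generate_incl[of "{wprod vs}"] wprod_closed alternating_carrier[OF vs(3)] by blast
  moreover have "generate G {c} \<subseteq> carrier G" using generate_incl[of "{c}"] c by blast
  ultimately show ?thesis using separable_conj[OF conjugate_in_sym[OF conj]] by blast
qed

end

section \<open>Free products with amalgamated retracts\<close>

text \<open>Each element is uniquely a product of an element of \<open>H\<close> and one of
  \<open>F\<close>; the retraction takes the first component.\<close>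

lemma retraction_hom:
  assumes "group A" "retract_of_group H A"
  shows "\<exists>r \<in> hom A (A\<lparr>carrier := H\<rparr>). \<forall>h \<in> H. r h = h"
proof -
  interpret group A by fact
  obtain F where H: "subgroup H A" and F: "F \<lhd> A" and HF: "carrier A = H <#>\<^bsub>A\<^esub> F" "H \<inter> F = {\<one>\<^bsub>A\<^esub>}"
    using assms(2) by (auto simp: retract_of_group_def)
  interpret F: normal F A by fact
  interpret H: subgroup H A by fact
  define r where "r a = (SOME h. h \<in> H \<and> inv\<^bsub>A\<^esub> h \<otimes>\<^bsub>A\<^esub> a \<in> F)" for a
  have r: "r a \<in> H \<and> inv\<^bsub>A\<^esub> (r a) \<otimes>\<^bsub>A\<^esub> a \<in> F" if "a \<in> carrier A" for a
  proof -
    obtain h f where hf: "h \<in> H" "f \<in> F" "a = h \<otimes>\<^bsub>A\<^esub> f" using \<open>a \<in> carrier A\<close> HF(1) by (auto simp: set_mult_def)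
    then have "inv\<^bsub>A\<^esub> h \<otimes>\<^bsub>A\<^esub> a \<in> F" by simp
    then show ?thesis
      unfolding r_def by (intro someI[of "\<lambda>h. h \<in> H \<and> inv\<^bsub>A\<^esub> h \<otimes>\<^bsub>A\<^esub> a \<in> F" h] conjI hf(1))
  qed
  have unique: "h = h'" if "h \<in> H" "h' \<in> H" "a \<in> carrier A" "inv\<^bsub>A\<^esub> h \<otimes>\<^bsub>A\<^esub> a \<in> F" "inv\<^bsub>A\<^esub> h' \<otimes>\<^bsub>A\<^esub> a \<in> F" for h h' a
  proof -
    have "(inv\<^bsub>A\<^esub> h \<otimes>\<^bsub>A\<^esub> a) \<otimes>\<^bsub>A\<^esub> inv\<^bsub>A\<^esub> (inv\<^bsub>A\<^esub> h' \<otimes>\<^bsub>A\<^esub> a) \<in> F"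
      by (rule F.m_closed[OF that(4) F.m_inv_closed[OF that(5)]])
    moreover have "(inv\<^bsub>A\<^esub> h \<otimes>\<^bsub>A\<^esub> a) \<otimes>\<^bsub>A\<^esub> inv\<^bsub>A\<^esub> (inv\<^bsub>A\<^esub> h' \<otimes>\<^bsub>A\<^esub> a) = inv\<^bsub>A\<^esub> h \<otimes>\<^bsub>A\<^esub> h'"
      using that by (simp add: inv_mult_group m_assoc)
    ultimately have "inv\<^bsub>A\<^esub> h \<otimes>\<^bsub>A\<^esub> h' = \<one>\<^bsub>A\<^esub>" using HF(2) that by auto
    then show ?thesis using that by (metis H.mem_carrier inv_equality inv_inv inv_closed)
  qed
  have "r (a \<otimes>\<^bsub>A\<^esub> b) = r a \<otimes>\<^bsub>A\<^esub> r b" if "a \<in> carrier A" "b \<in> carrier A" for a b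
  proof (rule unique[of _ _ "a \<otimes>\<^bsub>A\<^esub> b"])
    let ?x = "inv\<^bsub>A\<^esub> (r a) \<otimes>\<^bsub>A\<^esub> a" and ?y = "inv\<^bsub>A\<^esub> (r b) \<otimes>\<^bsub>A\<^esub> b"
    have ra: "r a \<in> carrier A" "r b \<in> carrier A" using r that by auto
    \<comment> \<open>Normality of \<open>F\<close> allows \<open>?x\<close> to be moved past
      \<open>r b\<close>.\<close>
    have "(inv\<^bsub>A\<^esub> (r b) \<otimes>\<^bsub>A\<^esub> ?x \<otimes>\<^bsub>A\<^esub> r b) \<otimes>\<^bsub>A\<^esub> ?y \<in> F"
      using r[OF that(1)] r[OF that(2)] by (intro F.m_closed[OF F.inv_op_closed1[OF ra(2)]]) blast+
    then show "inv\<^bsub>A\<^esub> (r a \<otimes>\<^bsub>A\<^esub> r b) \<otimes>\<^bsub>A\<^esub> (a \<otimes>\<^bsub>A\<^esub> b) \<in> F"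
      using ra that by (simp add: inv_mult_group m_assoc)
  qed (use r that in auto)
  moreover have "r h = h" if "h \<in> H" for h
    by (rule unique[of _ _ h]) (use r that in auto)
  ultimately show ?thesis using r by (intro bexI[of _ r]) (auto intro!: homI)
qed

text \<open>The map induced on the free product kills the relators, and its kernel is normal, so it
  contains their normal closure.\<close>

lemma amalgam_lift:
  assumes "group A" "group B" "group X" "H \<subseteq> carrier A" "\<phi> ` H \<subseteq> carrier B"
    and f: "f \<in> hom A X" and g: "g \<in> hom B X" and fg: "\<And>h. h \<in> H \<Longrightarrow> f h = g (\<phi> h)"
  shows "\<exists>k \<in> hom (amalgam A B H \<phi>) X. (\<forall>a \<in> carrier A. k (amalgam_inl A B H \<phi> a) = f a) \<and>
    (\<forall>b \<in> carrier B. k (amalgam_inr A B H \<phi> b) = g b)"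
proof -
  let ?F = "free_product A B" and ?N = "amalg_kernel A B H \<phi>"
  interpret F: group ?F using assms by (intro group_free_product)
  interpret X: group X by fact
  obtain h where h: "h \<in> hom ?F X" "\<And>a. a \<in> carrier A \<Longrightarrow> h (fp_inl A B a) = f a"
    "\<And>b. b \<in> carrier B \<Longrightarrow> h (fp_inr A B b) = g b"
    using free_product_lift[OF assms(1-3) f g] by blast
  interpret h: group_hom ?F X h using h(1) by unfold_locales
  have N: "?N \<lhd> ?F" using assms by (intro amalg_kernel_normal)
  have inl: "fp_inl A B a \<in> carrier ?F" if "a \<in> carrier A" for a
    using fp_inl_hom[OF assms(1,2)] that by (auto simp: hom_def)
  have inr: "fp_inr A B b \<in> carrier ?F" if "b \<in> carrier B" for b
    using fp_inr_hom[OF assms(1,2)] that by (auto simp: hom_def)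
  have "inv\<^bsub>?F\<^esub> fp_inl A B x \<otimes>\<^bsub>?F\<^esub> fp_inr A B (\<phi> x) \<in> kernel ?F X h" if "x \<in> H" for x
  proof -
    have x: "x \<in> carrier A" "\<phi> x \<in> carrier B" using that assms by auto
    then have "h (inv\<^bsub>?F\<^esub> fp_inl A B x \<otimes>\<^bsub>?F\<^esub> fp_inr A B (\<phi> x)) = inv\<^bsub>X\<^esub> f x \<otimes>\<^bsub>X\<^esub> g (\<phi> x)"
      using inl inr h by simp
    also have "\<dots> = \<one>\<^bsub>X\<^esub>" using fg[OF that] f x(1) by (auto simp: hom_def Pi_iff)
    finally show ?thesis using x inl inr by (simp add: kernel_def)
  qed
  then have "?N \<subseteq> kernel ?F X h"
    unfolding amalg_kernel_def normal_closure_def using h.normal_kernel by blast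
  then have "h x = h y" if "x \<in> carrier ?F" "y \<in> carrier ?F" "?N #>\<^bsub>?F\<^esub> x = ?N #>\<^bsub>?F\<^esub> y" for x y
  proof -
    have "x \<otimes>\<^bsub>?F\<^esub> inv\<^bsub>?F\<^esub> y \<in> kernel ?F X h"
      using \<open>?N \<subseteq> kernel ?F X h\<close> F.rcos_eq_iff[OF normal_imp_subgroup[OF N] that(1,2)] that(3) by blast
    then have "h x \<otimes>\<^bsub>X\<^esub> inv\<^bsub>X\<^esub> h y = \<one>\<^bsub>X\<^esub>" using that by (simp add: kernel_def)
    then show ?thesis using that by (metis X.inv_equality X.inv_inv X.inv_closed h.hom_closed)
  qed
  then obtain k where k: "k \<in> hom (?F Mod ?N) X" "\<And>x. x \<in> carrier ?F \<Longrightarrow> k (?N #>\<^bsub>?F\<^esub> x) = h x"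
    using FactGroup_universal[OF h(1) N] by blast
  then show ?thesis
    unfolding amalgam_def amalgam_inl_def amalgam_inr_def using h inl inr by (intro bexI[of _ k]) auto
qed

lemma amalgam_generated:
  assumes "group A" "group B" "H \<subseteq> carrier A" "\<phi> ` H \<subseteq> carrier B"
  shows "generate (amalgam A B H \<phi>) (amalgam_inl A B H \<phi> ` carrier A \<union> amalgam_inr A B H \<phi> ` carrier B) =
    carrier (amalgam A B H \<phi>)" (is "generate ?G ?S = _")
proof
  let ?F = "free_product A B" and ?N = "amalg_kernel A B H \<phi>"
  interpret G: group ?G using assms by (rule group_amalgam)
  interpret N: normal ?N ?F using assms by (rule amalg_kernel_normal)
  show "generate ?G ?S \<subseteq> carrier ?G"
    using amalgam_inl_hom[OF assms] amalgam_inr_hom[OF assms]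
    by (intro G.generate_incl) (auto simp: hom_def)
  have words: "?N #>\<^bsub>?F\<^esub> fp_class A B w \<in> generate ?G ?S" if "w \<in> fp_words A B" for w
    using that
  proof (induction w)
    case Nil
    have "?N #>\<^bsub>?F\<^esub> \<one>\<^bsub>?F\<^esub> = \<one>\<^bsub>?G\<^esub>" by (simp add: amalgam_def N.coset_mult_one[OF N.subset])
    moreover have "\<one>\<^bsub>?F\<^esub> = fp_class A B []" by (simp add: free_product_def)
    ultimately show ?case using generate.one[of ?G ?S] by simp
  next
    case (Cons x w)
    have w: "w \<in> fp_words A B" and x: "[x] \<in> fp_words A B" using Cons.hyps by simp_all
    have "?N #>\<^bsub>?F\<^esub> fp_class A B [x] \<in> ?S"
      using x by (cases x) (auto simp: amalgam_inl_def amalgam_inr_def fp_inl_def fp_inr_def)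
    then have "(?N #>\<^bsub>?F\<^esub> fp_class A B [x]) \<otimes>\<^bsub>?G\<^esub> (?N #>\<^bsub>?F\<^esub> fp_class A B w) \<in> generate ?G ?S"
      by (rule generate.eng[OF generate.incl Cons.IH])
    moreover have "fp_class A B v \<in> carrier ?F" if "v \<in> fp_words A B" for v
      using that by (simp add: free_product_def)
    ultimately show ?case
      using x w N.rcos_sum[of "fp_class A B [x]" "fp_class A B w"] fp_mult[OF assms(1,2) x w]
      by (simp add: amalgam_def)
  qed
  show "carrier ?G \<subseteq> generate ?G ?S"
  proof
    fix X assume "X \<in> carrier ?G"
    then have "X \<in> (\<lambda>x. ?N #>\<^bsub>?F\<^esub> x) ` carrier ?F" by (simp only: amalgam_def carrier_FactGroup)
    then obtain y where y: "X = ?N #>\<^bsub>?F\<^esub> y" "y \<in> carrier ?F" by (rule imageE)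
    have "carrier ?F = fp_class A B ` fp_words A B" by (simp add: free_product_def)
    then obtain w where "y = fp_class A B w" "w \<in> fp_words A B" using y(2) by blast
    then show "X \<in> generate ?G ?S" using words y(1) by simp
  qed
qed

lemma hom_into_supergroup:
  assumes "f \<in> hom X (Y\<lparr>carrier := Z\<rparr>)" "Z \<subseteq> carrier Y"
  shows "f \<in> hom X Y"
  using assms by (auto simp: hom_def)

section \<open>Cyclic subgroups of the amalgam\<close>

context exponents
begin

lemma separable_restrict:
  assumes "group G" "group A" "i \<in> hom A G" "inj_on i (carrier A)" "subgroup Y A" "separable \<P> (i ` Y) G"
  shows "separable \<P> Y A"
  unfolding separable_def
proof (intro conjI ballI)
  interpret G: group G by fact
  interpret A: group A by fact
  interpret i: group_hom A G i by unfold_locales fact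
  have Y: "Y \<subseteq> carrier A" using assms(5) by (rule subgroup.subset)
  fix g assume g: "g \<in> carrier A - Y"
  then have "i g \<in> carrier G - i ` Y" using inj_on_image_mem_iff[OF assms(4) _ Y] by auto
  then obtain U where U: "open_normal \<P> G U" "\<forall>y \<in> i ` Y. i g \<otimes>\<^bsub>G\<^esub> inv\<^bsub>G\<^esub> y \<notin> U"
    using assms(6) unfolding separable_def by blast
  show "\<exists>U. open_normal \<P> A U \<and> (\<forall>y\<in>Y. g \<otimes>\<^bsub>A\<^esub> inv\<^bsub>A\<^esub> y \<notin> U)"
    using i.open_normal_vimage[OF U(1)] U(2) g Y
    by (intro exI[of _ "{x \<in> carrier A. i x \<in> U}"]) (auto simp: subset_iff)
qed (fact assms(5))

lemma isolated_restrict: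
  assumes "group G" "group A" "i \<in> hom A G" "inj_on i (carrier A)" "subgroup Y A" "isolated (i ` Y) G"
  shows "isolated Y A"
proof -
  interpret G: group G by fact
  interpret A: group A by fact
  interpret i: group_hom A G i by unfold_locales fact
  have Y: "Y \<subseteq> carrier A" using assms(5) by (rule subgroup.subset)
  have "g \<in> Y" if "g \<in> carrier A" "\<forall>m\<in>\<P>. coprime n m" "g [^]\<^bsub>A\<^esub> n \<in> Y" for g and n :: nat
  proof -
    have "i g [^]\<^bsub>G\<^esub> n \<in> i ` Y" using that by (simp flip: i.hom_nat_pow)
    then have "i g \<in> i ` Y"
      by (rule assms(6)[unfolded isolated_def, THEN conjunct2, THEN bspec, OF i.hom_closed[OF that(1)],
            THEN spec, THEN mp, OF that(2), THEN mp])
    then show ?thesis using inj_on_image_mem_iff[OF assms(4) that(1) Y] by blast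
  qed
  then show ?thesis using assms(5) by (simp add: isolated_def)
qed

text \<open>Conjugation carries the subgroup onto the image of a cyclic subgroup of
  \<open>A\<close>, which inherits isolatedness. It is separable in \<open>A\<close> by
  \<open>sep\<close>, and in \<open>G\<close> because \<open>A\<close> is a retract.\<close>

lemma separable_elliptic:
  assumes "group G" "group A" "i \<in> hom A G" "r \<in> hom G A"
    and ri: "\<And>a. a \<in> carrier A \<Longrightarrow> r (i a) = a"
    and res: "separable \<P> {\<one>\<^bsub>G\<^esub>} G"
    and c: "c \<in> carrier G" "x \<in> carrier G" "a \<in> carrier A" "inv\<^bsub>G\<^esub> x \<otimes>\<^bsub>G\<^esub> c \<otimes>\<^bsub>G\<^esub> x = i a"
    and iso: "isolated (generate G {c}) G"
    and sep: "\<And>Y. cyclic_subgroup Y A \<Longrightarrow> isolated Y A \<Longrightarrow>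
      conjugate_in G (generate G {c}) (i ` Y) \<Longrightarrow> separable \<P> Y A"
  shows "separable \<P> (generate G {c}) G"
proof -
  interpret G: group G by fact
  interpret A: group A by fact
  interpret i: group_hom A G i by unfold_locales fact
  interpret h: group_hom G G "\<lambda>y. inv\<^bsub>G\<^esub> x \<otimes>\<^bsub>G\<^esub> y \<otimes>\<^bsub>G\<^esub> x"
    by unfold_locales (rule G.conj_hom[OF c(2)])
  let ?C = "generate G {c}" and ?Y = "generate A {a}"
  have Y: "subgroup ?Y A" using A.generate_is_subgroup[of "{a}"] c(3) by simp
  have iY: "i ` ?Y = generate G {i a}" using i.generate_img[of "{a}"] c(3) by simp
  have "(\<lambda>y. inv\<^bsub>G\<^esub> x \<otimes>\<^bsub>G\<^esub> y \<otimes>\<^bsub>G\<^esub> x) ` ?C = i ` ?Y"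
    unfolding iY using h.generate_img[of "{c}"] c(1,4) by simp
  then have conj: "conjugate_in G ?C (i ` ?Y)" using c(2) unfolding conjugate_in_def by blast
  have inj: "inj_on i (carrier A)" using ri by (rule inj_on_inverseI)
  have "isolated ?Y A"
    by (rule isolated_restrict[OF assms(1-3) inj Y isolated_conj[OF assms(1) conj iso]])
  then have sepY: "separable \<P> ?Y A" using sep conj c(3) by (auto simp: cyclic_subgroup_def)
  have "separable \<P> (i ` ?Y) G" by (rule separable_retract[OF assms(1-4) ri res sepY])
  moreover have "?C \<subseteq> carrier G" using G.generate_incl[of "{c}"] c(1) by blast
  ultimately show ?thesis using G.separable_conj[OF G.conjugate_in_sym[OF conj]] by blast
qed

text \<open>The retract lemma for all of \<open>H\<close>, which is trivially separable in
  itself.\<close>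

lemma separable_retract_subgroup:
  assumes "group A" "subgroup H A" "r \<in> hom A (A\<lparr>carrier := H\<rparr>)" "\<And>h. h \<in> H \<Longrightarrow> r h = h"
    "separable \<P> {\<one>\<^bsub>A\<^esub>} A"
  shows "separable \<P> H A"
proof -
  interpret A: group A by fact
  have H: "group (A\<lparr>carrier := H\<rparr>)" using assms(2) by (rule A.subgroup_imp_group)
  have "id \<in> hom (A\<lparr>carrier := H\<rparr>) A" using subgroup.subset[OF assms(2)] by (auto simp: hom_def)
  moreover have "separable \<P> H (A\<lparr>carrier := H\<rparr>)"
    using group.subgroup_self[OF H] by (simp add: separable_def)
  ultimately have "separable \<P> (id ` H) A"
    using assms by (intro separable_retract[OF assms(1) H _ assms(3)]) auto
  then show ?thesis by simp
qed

theorem cyclic_separable_iff: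
  fixes A :: "('a, 'm) monoid_scheme" and B :: "('b, 'n) monoid_scheme" and H :: "'a set" and K :: "'b set"
    and \<phi> :: "'a \<Rightarrow> 'b" and C :: "('a + 'b) list set set set"
  defines "G \<equiv> amalgam A B H \<phi>" and "\<iota>A \<equiv> amalgam_inl A B H \<phi>" and "\<iota>B \<equiv> amalgam_inr A B H \<phi>"
  assumes A: "group A" and B: "group B" and H: "subgroup H A" and K: "subgroup K B"
    and \<phi>: "\<phi> \<in> iso (A\<lparr>carrier := H\<rparr>) (B\<lparr>carrier := K\<rparr>)"
    and HA: "retract_of_group H A" and KB: "retract_of_group K B"
    and resA: "separable \<P> {\<one>\<^bsub>A\<^esub>} A" and resB: "separable \<P> {\<one>\<^bsub>B\<^esub>} B"
    and C: "cyclic_subgroup C G" "isolated C G"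
  shows "separable \<P> C G \<longleftrightarrow>
    \<not> (\<exists>D \<in> (`) \<iota>A ` {Y. cyclic_subgroup Y A \<and> isolated Y A \<and> \<not> separable \<P> Y A} \<union>
      (`) \<iota>B ` {Y. cyclic_subgroup Y B \<and> isolated Y B \<and> \<not> separable \<P> Y B}. conjugate_in G C D)"
proof -
  interpret A: group A by (rule A)
  interpret B: group B by (rule B)
  have HcA: "H \<subseteq> carrier A" using H by (rule subgroup.subset)
  have bij: "bij_betw \<phi> H K" using \<phi> by (simp add: iso_def)
  have \<phi>H: "\<phi> ` H = K" using bij by (simp add: bij_betw_def)
  have \<phi>K: "\<phi> h \<in> K" if "h \<in> H" for h using that \<phi>H by blast
  have HcB: "\<phi> ` H \<subseteq> carrier B" using \<phi>H subgroup.subset[OF K] by simp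
  have G: "group G" unfolding G_def by (rule group_amalgam[OF A B HcA HcB])
  interpret G: group G by (rule G)
  have \<iota>A: "\<iota>A \<in> hom A G" and \<iota>B: "\<iota>B \<in> hom B G"
    unfolding G_def \<iota>A_def \<iota>B_def by (rule amalgam_inl_hom[OF A B HcA HcB], rule amalgam_inr_hom[OF A B HcA HcB])
  interpret \<iota>A: group_hom A G \<iota>A by unfold_locales (rule \<iota>A)
  interpret \<iota>B: group_hom B G \<iota>B by unfold_locales (rule \<iota>B)
  have \<iota>AB: "\<iota>A h = \<iota>B (\<phi> h)" if "h \<in> H" for h
    unfolding \<iota>A_def \<iota>B_def by (rule amalgam_inl_eq_inr[OF A B HcA HcB that])
  obtain rA where rA: "rA \<in> hom A (A\<lparr>carrier := H\<rparr>)" "\<And>h. h \<in> H \<Longrightarrow> rA h = h"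
    using retraction_hom[OF A HA] by blast
  obtain rB where rB: "rB \<in> hom B (B\<lparr>carrier := K\<rparr>)" "\<And>k. k \<in> K \<Longrightarrow> rB k = k"
    using retraction_hom[OF B KB] by blast
  have rA_H: "rA a \<in> H" if "a \<in> carrier A" for a using rA(1) that by (auto simp: hom_def)
  have rB_K: "rB b \<in> K" if "b \<in> carrier B" for b using rB(1) that by (auto simp: hom_def)
  define \<psi> where "\<psi> = inv_into H \<phi>"
  have \<psi>: "\<psi> \<in> hom (B\<lparr>carrier := K\<rparr>) (A\<lparr>carrier := H\<rparr>)"
    using group.iso_set_sym[OF A.subgroup_imp_group[OF H] \<phi>] by (simp add: \<psi>_def iso_def)
  have \<psi>_\<phi>: "\<psi> (\<phi> h) = h" if "h \<in> H" for h
    using that bij by (simp add: \<psi>_def bij_betw_def)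
  have \<phi>_\<psi>: "\<phi> (\<psi> k) = k" if "k \<in> K" for k
    using that \<phi>H by (simp add: \<psi>_def f_inv_into_f)
  have \<psi>_H: "\<psi> k \<in> H" if "k \<in> K" for k using \<psi> that by (auto simp: hom_def)
  have rA_A: "rA \<in> hom A A" by (rule hom_into_supergroup[OF rA(1) HcA])
  have \<psi>rB: "\<psi> \<circ> rB \<in> hom B A"
    by (rule hom_into_supergroup[OF Group.hom_compose[OF rB(1) \<psi>] HcA])
  have \<phi>rA: "\<phi> \<circ> rA \<in> hom A B"
    by (rule hom_into_supergroup[OF Group.hom_compose[OF rA(1)] subgroup.subset[OF K]])
      (use \<phi> in \<open>simp add: iso_def\<close>)
  \<comment> \<open>Retractions of \<open>G\<close> onto the factors: the identity on one factor,
    and on the other the retraction onto its amalgamated subgroup followed by the identification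
    with the other copy. The two definitions agree on the amalgamated subgroup.\<close>
  obtain pA where pA: "pA \<in> hom G A" "\<And>a. a \<in> carrier A \<Longrightarrow> pA (\<iota>A a) = a"
    "\<And>b. b \<in> carrier B \<Longrightarrow> pA (\<iota>B b) = \<psi> (rB b)"
    using amalgam_lift[OF A B A HcA HcB _ \<psi>rB, of id] \<psi>_\<phi> \<phi>K rB(2)
    by (auto simp: hom_def G_def \<iota>A_def \<iota>B_def)
  obtain pB where pB: "pB \<in> hom G B" "\<And>a. a \<in> carrier A \<Longrightarrow> pB (\<iota>A a) = \<phi> (rA a)"
    "\<And>b. b \<in> carrier B \<Longrightarrow> pB (\<iota>B b) = b"
    using amalgam_lift[OF A B B HcA HcB \<phi>rA, of id] rA(2)
    by (auto simp: hom_def G_def \<iota>A_def \<iota>B_def)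
  interpret pA: group_hom G A pA by unfold_locales (rule pA)
  interpret pB: group_hom G B pB by unfold_locales (rule pB)
  have sepH: "separable \<P> H A" by (rule separable_retract_subgroup[OF A H rA resA])
  have sepK: "separable \<P> K B" by (rule separable_retract_subgroup[OF B K rB resB])
  \<comment> \<open>The role of \<open>\<rho>\<close> is played by the retraction of
    \<open>G\<close> onto the amalgamated subgroup that passes through \<open>A\<close>.\<close>
  interpret S: separating_amalgam G "\<iota>A ` carrier A" "\<iota>B ` carrier B" "\<iota>A ` H"
    "\<iota>A \<circ> pA" "\<iota>B \<circ> pB" "\<iota>A \<circ> (rA \<circ> pA)" \<P>
  proof (intro separating_amalgam.intro amalgamated_retracts.intro amalgamated_retracts_axioms.intro
      separating_amalgam_axioms.intro G exponents_axioms)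
    show "subgroup (\<iota>A ` carrier A) G" by (rule \<iota>A.subgroup_img_is_subgroup[OF A.subgroup_self])
    show "subgroup (\<iota>B ` carrier B) G" by (rule \<iota>B.subgroup_img_is_subgroup[OF B.subgroup_self])
    show "subgroup (\<iota>A ` H) G" by (rule \<iota>A.subgroup_img_is_subgroup[OF H])
    show "\<iota>A ` H \<subseteq> \<iota>A ` carrier A" using HcA by blast
    show "\<iota>A ` H \<subseteq> \<iota>B ` carrier B" using \<iota>AB HcB by auto
    show "generate G (\<iota>A ` carrier A \<union> \<iota>B ` carrier B) = carrier G"
      unfolding G_def \<iota>A_def \<iota>B_def by (rule amalgam_generated[OF A B HcA HcB])
    show "\<iota>A \<circ> pA \<in> hom G G" by (rule Group.hom_compose[OF pA(1) \<iota>A])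
    show "\<iota>B \<circ> pB \<in> hom G G" by (rule Group.hom_compose[OF pB(1) \<iota>B])
    show "\<iota>A \<circ> (rA \<circ> pA) \<in> hom G G"
      by (rule Group.hom_compose[OF Group.hom_compose[OF pA(1) rA_A] \<iota>A])
    show "(\<iota>A \<circ> pA) x = x" if "x \<in> \<iota>A ` carrier A" for x using that pA(2) by auto
    show "(\<iota>A \<circ> pA) x = (\<iota>A \<circ> (rA \<circ> pA)) x" if "x \<in> \<iota>B ` carrier B" for x
      using that pA(3) rA(2) \<psi>_H rB_K by auto
    show "(\<iota>B \<circ> pB) x = x" if "x \<in> \<iota>B ` carrier B" for x using that pB(3) by auto
    show "(\<iota>B \<circ> pB) x = (\<iota>A \<circ> (rA \<circ> pA)) x" if "x \<in> \<iota>A ` carrier A" for x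
      using that pA(2) pB(2) \<iota>AB rA_H by auto
    show "(\<iota>A \<circ> (rA \<circ> pA)) x \<in> \<iota>A ` H" if "x \<in> carrier G" for x
      using that rA_H by auto
    show "(\<iota>A \<circ> (rA \<circ> pA)) x = x" if "x \<in> \<iota>A ` H" for x
      using that pA(2) rA(2) HcA by auto
    show "\<exists>k \<in> hom G op_bij_group. (\<forall>a\<in>\<iota>A ` carrier A. k a = f a) \<and> (\<forall>b\<in>\<iota>B ` carrier B. k b = g b)"
      if f: "f \<in> hom (G\<lparr>carrier := \<iota>A ` carrier A\<rparr>)
          (op_bij_group :: ((('a + 'b) list set set set list \<Rightarrow> int) \<Rightarrow> _) monoid)"
        and g: "g \<in> hom (G\<lparr>carrier := \<iota>B ` carrier B\<rparr>) op_bij_group"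
        and fg: "\<And>h. h \<in> \<iota>A ` H \<Longrightarrow> f h = g h" for f g
    proof -
      have "f \<circ> \<iota>A \<in> hom A op_bij_group" "g \<circ> \<iota>B \<in> hom B op_bij_group"
        using f g by (auto simp: hom_def)
      moreover have "(f \<circ> \<iota>A) h = (g \<circ> \<iota>B) (\<phi> h)" if "h \<in> H" for h
        using fg[OF imageI[OF that]] by (simp add: \<iota>AB[OF that])
      ultimately show ?thesis
        using amalgam_lift[OF A B group_op_bij_group HcA HcB, of "f \<circ> \<iota>A" "g \<circ> \<iota>B"]
        by (simp add: G_def \<iota>A_def \<iota>B_def)
    qed
    show "\<exists>U. open_normal \<P> G U \<and> (\<forall>h\<in>\<iota>A ` H. x \<otimes>\<^bsub>G\<^esub> inv\<^bsub>G\<^esub> h \<notin> U)"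
      if x: "x \<in> \<iota>A ` carrier A \<union> \<iota>B ` carrier B" "x \<notin> \<iota>A ` H" for x
      using x(1)
    proof
      assume "x \<in> \<iota>A ` carrier A"
      then obtain a where a: "x = \<iota>A a" "a \<in> carrier A" by blast
      then have "a \<in> carrier A - H" using x(2) by blast
      then obtain U where U: "open_normal \<P> A U" "\<forall>h\<in>H. a \<otimes>\<^bsub>A\<^esub> inv\<^bsub>A\<^esub> h \<notin> U"
        using sepH unfolding separable_def by blast
      show ?thesis
        using pA.open_normal_vimage[OF U(1)] U(2) a pA(2) HcA
        by (intro exI[of _ "{x \<in> carrier G. pA x \<in> U}"]) (auto simp: subset_iff)
    next
      assume "x \<in> \<iota>B ` carrier B"
      then obtain b where b: "x = \<iota>B b" "b \<in> carrier B" by blast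
      have "b \<notin> K"
      proof
        assume "b \<in> K"
        then obtain h where "h \<in> H" "b = \<phi> h" using \<phi>H by blast
        then show False using \<iota>AB[of h] b x(2) by auto
      qed
      then obtain U where U: "open_normal \<P> B U" "\<forall>k\<in>K. b \<otimes>\<^bsub>B\<^esub> inv\<^bsub>B\<^esub> k \<notin> U"
        using sepK b(2) unfolding separable_def by blast
      have "pB (x \<otimes>\<^bsub>G\<^esub> inv\<^bsub>G\<^esub> \<iota>A h) \<notin> U" if "h \<in> H" for h
      proof -
        have "\<phi> h \<in> carrier B" "\<phi> h \<in> K" using that HcB \<phi>K by auto
        then show ?thesis using U(2) b pB(3) \<iota>AB[OF that] by simp
      qed
      then show ?thesis
        using pB.open_normal_vimage[OF U(1)] by (intro exI[of _ "{x \<in> carrier G. pB x \<in> U}"]) auto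
    qed
    show "\<exists>U. open_normal \<P> G U \<and> x \<notin> U" if x: "x \<in> \<iota>A ` H" "x \<noteq> \<one>\<^bsub>G\<^esub>" for x
    proof -
      obtain h where h: "h \<in> H" "x = \<iota>A h" using x(1) by blast
      then have hc: "h \<in> carrier A" "h \<noteq> \<one>\<^bsub>A\<^esub>" using x(2) HcA by auto
      then obtain U where U: "open_normal \<P> A U" "h \<notin> U"
        using resA unfolding separable_def by fastforce
      show ?thesis
        using pA.open_normal_vimage[OF U(1)] U(2) h(2) hc(1) pA(2)
        by (intro exI[of _ "{x \<in> carrier G. pA x \<in> U}"]) auto
    qed
  qed
  have injA: "inj_on \<iota>A (carrier A)" using pA(2) by (rule inj_on_inverseI)
  have injB: "inj_on \<iota>B (carrier B)" using pB(3) by (rule inj_on_inverseI)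
  obtain c where c: "c \<in> carrier G" "C = generate G {c}" using C(1) by (auto simp: cyclic_subgroup_def)
  have Cc: "C \<subseteq> carrier G" using G.generate_incl[of "{c}"] c by blast
  show ?thesis
  proof
    \<comment> \<open>Separability passes to the conjugate subgroup and then restricts to the
      factor, which embeds because it has a retraction.\<close>
    assume sep: "separable \<P> C G"
    have "separable \<P> Y A" if "cyclic_subgroup Y A" "conjugate_in G C (\<iota>A ` Y)" for Y
    proof -
      have "subgroup Y A" using that(1) A.generate_is_subgroup by (auto simp: cyclic_subgroup_def)
      then show ?thesis
        using separable_restrict[OF G A \<iota>A injA] G.separable_conj[OF that(2) sep] by blast
    qed
    moreover have "separable \<P> Y B" if "cyclic_subgroup Y B" "conjugate_in G C (\<iota>B ` Y)" for Y
    proof -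
      have "subgroup Y B" using that(1) B.generate_is_subgroup by (auto simp: cyclic_subgroup_def)
      then show ?thesis
        using separable_restrict[OF G B \<iota>B injB] G.separable_conj[OF that(2) sep] by blast
    qed
    ultimately show "\<not> (\<exists>D \<in> (`) \<iota>A ` {Y. cyclic_subgroup Y A \<and> isolated Y A \<and> \<not> separable \<P> Y A} \<union>
      (`) \<iota>B ` {Y. cyclic_subgroup Y B \<and> isolated Y B \<and> \<not> separable \<P> Y B}. conjugate_in G C D)"
      by blast
  next
    assume no_conj: "\<not> (\<exists>D \<in> (`) \<iota>A ` {Y. cyclic_subgroup Y A \<and> isolated Y A \<and> \<not> separable \<P> Y A} \<union>
      (`) \<iota>B ` {Y. cyclic_subgroup Y B \<and> isolated Y B \<and> \<not> separable \<P> Y B}. conjugate_in G C D)"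
    note iso = C(2)[unfolded c(2)]
    consider "\<And>x. x \<in> carrier G \<Longrightarrow> inv\<^bsub>G\<^esub> x \<otimes>\<^bsub>G\<^esub> c \<otimes>\<^bsub>G\<^esub> x \<notin> \<iota>A ` carrier A \<union> \<iota>B ` carrier B"
      | x a where "x \<in> carrier G" "a \<in> carrier A" "inv\<^bsub>G\<^esub> x \<otimes>\<^bsub>G\<^esub> c \<otimes>\<^bsub>G\<^esub> x = \<iota>A a"
      | x b where "x \<in> carrier G" "b \<in> carrier B" "inv\<^bsub>G\<^esub> x \<otimes>\<^bsub>G\<^esub> c \<otimes>\<^bsub>G\<^esub> x = \<iota>B b"
      by blast
    then show "separable \<P> C G"
    proof cases
      case 1
      then show ?thesis unfolding c(2) by (intro S.separable_hyperbolic c(1) iso)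
    next
      case 2
      show ?thesis unfolding c(2)
        by (rule separable_elliptic[OF G A \<iota>A pA(1,2) S.residually_separable c(1) 2 iso])
          (use no_conj c(2) in blast)+
    next
      case 3
      show ?thesis unfolding c(2)
        by (rule separable_elliptic[OF G B \<iota>B pB(1,3) S.residually_separable c(1) 3 iso])
          (use no_conj c(2) in blast)+
    qed
  qed
qed

end

section \<open>The finite and the p-finite case\<close>

lemma (in group) subgroup_cyclic: "cyclic_subgroup Y G \<Longrightarrow> subgroup Y G"
  using generate_is_subgroup by (auto simp: cyclic_subgroup_def)

text \<open>Every subgroup is isolated with respect to the set of all positive integers, which gives
  this family the same form as \<open>Delta_p\<close>.\<close>

lemma (in group) Delta_eq:
  "Delta G = {Y. cyclic_subgroup Y G \<and> exponents.isolated {0<..} Y G \<and> \<not> separable {0<..} Y G}"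
  using subgroup_cyclic by (auto simp: Delta_def finitely_separable_iff isolated_positive_iff)

lemma (in group) Delta_p_eq:
  assumes "prime p"
  shows "Delta_p p G = {Y. cyclic_subgroup Y G \<and> exponents.isolated (range ((^) p)) Y G \<and>
    \<not> separable (range ((^) p)) Y G}"
  by (simp add: Delta_p_def p_separable_iff[OF assms] isolated_prime_powers_iff[OF assms])

theorem mainTheorem1:
  fixes A :: "('a, 'm) monoid_scheme" and B :: "('b, 'n) monoid_scheme"
    and H :: "'a set" and K :: "'b set" and \<phi> :: "'a \<Rightarrow> 'b" and p :: nat
  defines "G \<equiv> amalgam A B H \<phi>"
    and "\<iota>A \<equiv> amalgam_inl A B H \<phi>"
    and "\<iota>B \<equiv> amalgam_inr A B H \<phi>"
  assumes "group A" and "group B"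
    and "subgroup H A" and "subgroup K B"
    and "\<phi> \<in> iso (A\<lparr>carrier := H\<rparr>) (B\<lparr>carrier := K\<rparr>)"
    and "retract_of_group H A" and "retract_of_group K B"
    and "prime p"
  shows "(residually_finite A \<and> residually_finite B \<longrightarrow>
      (\<forall>C. cyclic_subgroup C G \<longrightarrow>
        (finitely_separable C G \<longleftrightarrow>
          \<not> (\<exists>D \<in> (`) \<iota>A ` Delta A \<union> (`) \<iota>B ` Delta B. conjugate_in G C D))))
    \<and> (residually_p_finite p A \<and> residually_p_finite p B \<longrightarrow>
      (\<forall>C. cyclic_subgroup C G \<and> p'_isolated p C G \<longrightarrow>
        (p_separable p C G \<longleftrightarrow>
          \<not> (\<exists>D \<in> (`) \<iota>A ` Delta_p p A \<union> (`) \<iota>B ` Delta_p p B. conjugate_in G C D))))"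
proof -
  interpret A: group A by fact
  interpret B: group B by fact
  have "\<phi> ` H = K" using assms(8) by (simp add: iso_def bij_betw_def)
  then have "group (amalgam A B H \<phi>)"
    using group_amalgam[OF assms(4,5) subgroup.subset[OF assms(6)]] subgroup.subset[OF assms(7)] by blast
  then interpret G: group G by (simp only: G_def)
  show ?thesis
  proof (intro conjI impI allI; elim conjE)
    fix C assume res: "residually_finite A" "residually_finite B" and C: "cyclic_subgroup C G"
    have "separable {0<..} {\<one>\<^bsub>A\<^esub>} A" "separable {0<..} {\<one>\<^bsub>B\<^esub>} B"
      using res by (simp_all add: residually_finite_def A.finitely_separable_iff B.finitely_separable_iff)
    moreover have "exponents.isolated {0<..} C G"
      using G.subgroup_cyclic[OF C] by (simp add: G.isolated_positive_iff)
    ultimately show "finitely_separable C G \<longleftrightarrow>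
        \<not> (\<exists>D \<in> (`) \<iota>A ` Delta A \<union> (`) \<iota>B ` Delta B. conjugate_in G C D)"
      unfolding G.finitely_separable_iff A.Delta_eq B.Delta_eq using C unfolding G_def \<iota>A_def \<iota>B_def
      by (intro exponents.cyclic_separable_iff[OF exponents_positive assms(4-10)])
  next
    fix C assume res: "residually_p_finite p A" "residually_p_finite p B"
      and C: "cyclic_subgroup C G" "p'_isolated p C G"
    have "separable (range ((^) p)) {\<one>\<^bsub>A\<^esub>} A" "separable (range ((^) p)) {\<one>\<^bsub>B\<^esub>} B"
      using res by (simp_all add: residually_p_finite_def A.p_separable_iff[OF assms(11)]
        B.p_separable_iff[OF assms(11)])
    moreover have "exponents.isolated (range ((^) p)) C G"
      using C(2) by (simp add: G.isolated_prime_powers_iff[OF assms(11)])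
    ultimately show "p_separable p C G \<longleftrightarrow>
        \<not> (\<exists>D \<in> (`) \<iota>A ` Delta_p p A \<union> (`) \<iota>B ` Delta_p p B. conjugate_in G C D)"
      unfolding G.p_separable_iff[OF assms(11)] A.Delta_p_eq[OF assms(11)] B.Delta_p_eq[OF assms(11)]
      using C(1) unfolding G_def \<iota>A_def \<iota>B_def
      by (intro exponents.cyclic_separable_iff[OF exponents_prime_powers[OF assms(11)] assms(4-10)])
  qed
qed

end
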